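(* Let $f:[0,1]\times\mathbb{R}^2\to\mathbb{R}$ be continuous and consider the periodic boundary value problem $$-x''=f(t,x,x')\quad (t\in[0,1]),\qquad x(0)=x(1),\quad x'(0)=x'(1). \qquad (P)$$ Suppose that there are a lower solution $\alpha$ and an upper solution $\beta$ of $(P)$ and constants $a,b,\delta\in\mathbb{R}$ with $a>0$ such that $$f(t,\beta(t),\beta'(t))-f(t,\alpha(t),\alpha'(t))\ge -a(\beta(t)-\alpha(t))+b(\beta'(t)-\alpha'(t))-\delta\quad (t\in[0,1]),$$ and that there is a number $\Delta\ge\delta/2$ such that for all $\eta\in A_\Delta$ and all $t\in[0,1]$, $$f(t,\eta(t),\eta'(t))+\alpha''(t)\ge -a(\eta(t)-\alpha(t))+b(\eta'(t)-\alpha'(t))-\Delta,$$ $$f(t,\eta(t),\eta'(t))+\beta''(t)\le a(\beta(t)-\eta(t))-b(\beta'(t)-\eta'(t))+\Delta,$$ where $A_\Delta\subset C^1[0,1]$ is the set defined in the context from $\alpha,\beta,a,b,\Delta$. Then problem $(P)$ has a solution $x$ with $x\in A_\Delta$.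
   Context: A function $\alpha\in C^2[0,1]$ is a lower solution of $(P)$ if $-\alpha''(t)\le f(t,\alpha(t),\alpha'(t))$ for $t\in[0,1]$ and $\alpha(0)=\alpha(1)$. A function $\beta\in C^2[0,1]$ is an upper solution of $(P)$ if $-\beta''(t)\ge f(t,\beta(t),\beta'(t))$ for $t\in[0,1]$ and $\beta(0)=\beta(1)$. (No ordering of $\alpha,\beta$ and no condition on their derivatives at the endpoints is assumed.) Put $r_1=\alpha'(0)-\alpha'(1)$ and $r_2=\beta'(1)-\beta'(0)$. For $a>0$, $b\in\mathbb{R}$, let $\lambda_1=\frac{-b+\sqrt{b^2+4a}}{2}>0$ and $\lambda_2=\frac{-b-\sqrt{b^2+4a}}{2}<0$, and let $$h(t)=\frac{(1-e^{\lambda_2})e^{\lambda_1t}+(e^{\lambda_1}-1)e^{\lambda_2t}}{(\lambda_1-\lambda_2)(e^{\lambda_1}-1)(1-e^{\lambda_2})},$$ which is the unique solution of $-h''=-ah+bh'$ on $[0,1]$ with $h(1)-h(0)=0$, $h'(1)-h'(0)=1$. Let $k_0=-h'(0)/h(0)$. Define $\overline\alpha_1(t)=\alpha(t)+r_1h(t)-\Delta/a$, $\overline\beta_1(t)=\beta(t)-r_2h(t)+\Delta/a$, and for $\eta\in\mathbb{R}$, $\overline\psi_1(\eta,t)=\overline\alpha_1'(t)-k_0(\eta-\overline\alpha_1(t))$, $\overline\psi_2(\eta,t)=\overline\beta_1'(t)+k_0(\overline\beta_1(t)-\eta)$. Then $$A_\Delta=\{\eta\in C^1[0,1]:\ \overline\alpha_1(t)\le\eta(t)\le\overline\beta_1(t),\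 \overline\psi_1(\eta(t),t)\le\eta'(t)\le\overline\psi_2(\eta(t),t)\ \text{for all } t\in[0,1]\}.$$ *)

theory Defs
  imports "HOL-Analysis.Analysis"
begin

text \<open>
  Functions on $[0,1]$ are total functions of type \<^typ>\<open>real \<Rightarrow> real\<close> of which only the values on
  \<^term>\<open>{0..1::real}\<close> matter.  Derivatives are accordingly taken within \<^term>\<open>{0..1::real}\<close>, hence
  are one-sided at the two endpoints.
\<close>

definition D01 :: "(real \<Rightarrow> real) \<Rightarrow> real \<Rightarrow> real" where
  "D01 u t = vector_derivative u (at t within {0..1})"

definition C1_01 :: "(real \<Rightarrow> real) \<Rightarrow> bool" where
  "C1_01 u \<longleftrightarrow> u differentiable_on {0..1} \<and> continuous_on {0..1} (D01 u)"

definition C2_01 :: "(real \<Rightarrow> real) \<Rightarrow> bool" where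
  "C2_01 u \<longleftrightarrow> C1_01 u \<and> C1_01 (D01 u)"

definition solution_P :: "(real \<Rightarrow> real \<Rightarrow> real \<Rightarrow> real) \<Rightarrow> (real \<Rightarrow> real) \<Rightarrow> bool" where
  "solution_P f x \<longleftrightarrow> C2_01 x \<and>
     (\<forall>t\<in>{0..1}. - D01 (D01 x) t = f t (x t) (D01 x t)) \<and>
     x 0 = x 1 \<and> D01 x 0 = D01 x 1"

definition lower_solution :: "(real \<Rightarrow> real \<Rightarrow> real \<Rightarrow> real) \<Rightarrow> (real \<Rightarrow> real) \<Rightarrow> bool" where
  "lower_solution f \<alpha> \<longleftrightarrow> C2_01 \<alpha> \<and>
     (\<forall>t\<in>{0..1}. - D01 (D01 \<alpha>) t \<le> f t (\<alpha> t) (D01 \<alpha> t)) \<and> \<alpha> 0 = \<alpha> 1"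

definition upper_solution :: "(real \<Rightarrow> real \<Rightarrow> real \<Rightarrow> real) \<Rightarrow> (real \<Rightarrow> real) \<Rightarrow> bool" where
  "upper_solution f \<beta> \<longleftrightarrow> C2_01 \<beta> \<and>
     (\<forall>t\<in>{0..1}. - D01 (D01 \<beta>) t \<ge> f t (\<beta> t) (D01 \<beta> t)) \<and> \<beta> 0 = \<beta> 1"

definition lam1 :: "real \<Rightarrow> real \<Rightarrow> real" where
  "lam1 a b = (- b + sqrt (b\<^sup>2 + 4 * a)) / 2"

definition lam2 :: "real \<Rightarrow> real \<Rightarrow> real" where
  "lam2 a b = (- b - sqrt (b\<^sup>2 + 4 * a)) / 2"

text \<open>
  For $a > 0$ this is the unique solution of $-h'' = -a h + b h'$ on $[0,1]$ with
  $h(1) = h(0)$ and $h'(1) - h'(0) = 1$.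
\<close>

definition hfun :: "real \<Rightarrow> real \<Rightarrow> real \<Rightarrow> real" where
  "hfun a b t =
     ((1 - exp (lam2 a b)) * exp (lam1 a b * t) + (exp (lam1 a b) - 1) * exp (lam2 a b * t)) /
     ((lam1 a b - lam2 a b) * (exp (lam1 a b) - 1) * (1 - exp (lam2 a b)))"

definition k0 :: "real \<Rightarrow> real \<Rightarrow> real" where
  "k0 a b = - D01 (hfun a b) 0 / hfun a b 0"

definition r1 :: "(real \<Rightarrow> real) \<Rightarrow> real" where
  "r1 \<alpha> = D01 \<alpha> 0 - D01 \<alpha> 1"

definition r2 :: "(real \<Rightarrow> real) \<Rightarrow> real" where
  "r2 \<beta> = D01 \<beta> 1 - D01 \<beta> 0"

definition alpha_bar :: "real \<Rightarrow> real \<Rightarrow> real \<Rightarrow> (real \<Rightarrow> real) \<Rightarrow> real \<Rightarrow> real" where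
  "alpha_bar a b \<Delta> \<alpha> t = \<alpha> t + r1 \<alpha> * hfun a b t - \<Delta> / a"

definition beta_bar :: "real \<Rightarrow> real \<Rightarrow> real \<Rightarrow> (real \<Rightarrow> real) \<Rightarrow> real \<Rightarrow> real" where
  "beta_bar a b \<Delta> \<beta> t = \<beta> t - r2 \<beta> * hfun a b t + \<Delta> / a"

definition psi1 :: "real \<Rightarrow> real \<Rightarrow> real \<Rightarrow> (real \<Rightarrow> real) \<Rightarrow> real \<Rightarrow> real \<Rightarrow> real" where
  "psi1 a b \<Delta> \<alpha> y t = D01 (alpha_bar a b \<Delta> \<alpha>) t - k0 a b * (y - alpha_bar a b \<Delta> \<alpha> t)"

definition psi2 :: "real \<Rightarrow> real \<Rightarrow> real \<Rightarrow> (real \<Rightarrow> real) \<Rightarrow> real \<Rightarrow> real \<Rightarrow> real" where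
  "psi2 a b \<Delta> \<beta> y t = D01 (beta_bar a b \<Delta> \<beta>) t + k0 a b * (beta_bar a b \<Delta> \<beta> t - y)"

definition A_set ::
  "real \<Rightarrow> real \<Rightarrow> (real \<Rightarrow> real) \<Rightarrow> (real \<Rightarrow> real) \<Rightarrow> real \<Rightarrow> (real \<Rightarrow> real) set" where
  "A_set a b \<alpha> \<beta> \<Delta> = {\<eta>. C1_01 \<eta> \<and>
     (\<forall>t\<in>{0..1}. alpha_bar a b \<Delta> \<alpha> t \<le> \<eta> t \<and> \<eta> t \<le> beta_bar a b \<Delta> \<beta> t \<and>
        psi1 a b \<Delta> \<alpha> (\<eta> t) t \<le> D01 \<eta> t \<and> D01 \<eta> t \<le> psi2 a b \<Delta> \<beta> (\<eta> t) t)}"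

end

theory Submission
  imports Defs "HOL-Complex_Analysis.Great_Picard"
begin

text \<open>
  Write $Lx = -x'' + ax - bx'$ and $k = k_0$.  The function $h$, extended with period $1$, is the Green
  function of $L$ with periodic boundary conditions, and $k_0$ is chosen so that $h' + k_0 h \ge 0$;
  hence a periodic $x$ with $Lx \ge 0$ satisfies $x' + kx \ge 0$, and then also $x \ge 0$.

  A periodic $\eta$ is determined by $v = \eta' + k\eta$, and the periodic elements of $A_\Delta$
  correspond exactly to the continuous $v$ in the order interval between
  $\overline\alpha_1' + k\overline\alpha_1$ and $\overline\beta_1' + k\overline\beta_1$.  Let $x$ be the
  periodic solution of $Lx = f(t,\eta,\eta') + a\eta - b\eta'$.  The hypotheses say that
  $L\overline\alpha_1 \le Lx \le L\overline\beta_1$, so $v \mapsto x' + kx$ maps this order interval into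
  itself; its values are equi-Lipschitz, and Schauder's theorem yields a fixed point.  Schauder's theorem
  is reduced to Brouwer's theorem for cubes of arbitrary dimension, taken from the Kuhn lemma.
\<close>

section \<open>Fixed point theorems\<close>

text \<open>The dimension is a term, not a type, because it will be the size of a finite net
  obtained inside a proof. Padding with zeros embeds every cube in the one metrizable space
  \<open>nat \<Rightarrow> real\<close>.\<close>

definition unit_cube :: "nat \<Rightarrow> (nat \<Rightarrow> real) set" where
  "unit_cube n = {x. \<forall>i. if i < n then 0 \<le> x i \<and> x i \<le> 1 else x i = 0}"

lemma unit_cube_memI:
  assumes "\<And>i. i < n \<Longrightarrow> 0 \<le> x i" "\<And>i. i < n \<Longrightarrow> x i \<le> 1" "\<And>i. \<not> i < n \<Longrightarrow> x i = 0"
  shows "x \<in> unit_cube n"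
  using assms by (auto simp: unit_cube_def)

text \<open>Tychonoff: the cube is a product of unit intervals and singletons.\<close>

lemma compact_unit_cube: "compact (unit_cube n)"
proof -
  have "unit_cube n = PiE UNIV (\<lambda>i. if i < n then {0..1} else {0})"
    by (auto simp: unit_cube_def PiE_def Pi_def extensional_def split: if_splits)
  moreover have "compactin (product_topology (\<lambda>_. euclidean) UNIV)
      (PiE UNIV (\<lambda>i. if i < n then {0..1::real} else {0}))"
    by (subst compactin_PiE) (simp add: compactin_euclidean_iff)
  ultimately show ?thesis
    by (simp add: euclidean_product_topology compactin_euclidean_iff)
qed

lemma LIMSEQ_coordinatewise:
  fixes X :: "nat \<Rightarrow> 'a \<Rightarrow> 'b::topological_space"
  shows "X \<longlonglongrightarrow> x \<longleftrightarrow> (\<forall>i. (\<lambda>m. X m i) \<longlonglongrightarrow> x i)"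
  using limitin_componentwise[of "\<lambda>_. euclidean" UNIV X x sequentially]
  by (simp add: euclidean_product_topology)

text \<open>Label a point \<open>x\<close> in direction \<open>i\<close> by 0 only if
  \<open>F\<close> does not decrease that coordinate, by 1 only if \<open>F\<close> does not
  increase it. Kuhn's lemma finds a cell of the grid of mesh \<open>1 / p\<close> on whose vertices
  both labels occur in every direction; \<open>u\<close> and \<open>v\<close> are such vertices and
  may depend on \<open>i\<close>.\<close>

lemma kuhn_grid_point:
  assumes F: "F ` unit_cube n \<subseteq> unit_cube n" and "0 < p"
  obtains x where "x \<in> unit_cube n"
    and "\<And>i. i < n \<Longrightarrow> \<exists>u\<in>unit_cube n. \<exists>v\<in>unit_cube n.
           (\<forall>j. \<bar>u j - x j\<bar> \<le> 1 / real p \<and> \<bar>v j - x j\<bar> \<le> 1 / real p) \<and> u i \<le> F u i \<and> F v i \<le> v i"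
proof -
  obtain l where l1: "\<forall>x i. l x i \<le> (1::nat)"
    and l2: "\<forall>x i. x \<in> unit_cube n \<and> i < n \<and> x i = 0 \<longrightarrow> l x i = 0"
    and l3: "\<forall>x i. x \<in> unit_cube n \<and> i < n \<and> x i = 1 \<longrightarrow> l x i = 1"
    and l4: "\<forall>x i. x \<in> unit_cube n \<and> i < n \<and> l x i = 0 \<longrightarrow> x i \<le> F x i"
    and l5: "\<forall>x i. x \<in> unit_cube n \<and> i < n \<and> l x i = 1 \<longrightarrow> F x i \<le> x i"
  proof -
    have "\<forall>x. x \<in> unit_cube n \<longrightarrow> F x \<in> unit_cube n"
      using F by blast
    moreover have "\<forall>x. x \<in> unit_cube n \<longrightarrow> (\<forall>i. i < n \<longrightarrow> 0 \<le> x i \<and> x i \<le> 1)"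
      by (auto simp: unit_cube_def)
    ultimately show thesis
      using kuhn_labelling_lemma'[of "\<lambda>x. x \<in> unit_cube n" F "\<lambda>i. i < n"] that by blast
  qed
  \<comment> \<open>\<open>g\<close> scales integer grid points with entries up to \<open>p\<close>
    into the cube.\<close>
  define g where "g z i = (if i < n then real (z i) / real p else 0)" for z :: "nat \<Rightarrow> nat" and i
  have g: "g z \<in> unit_cube n" if "\<forall>i<n. z i \<le> p" for z
    using that \<open>0 < p\<close> by (auto intro!: unit_cube_memI simp: g_def divide_simps)
  obtain q where q: "\<forall>i<n. q i < p"
    and rs: "\<forall>i<n. \<exists>r s. (\<forall>j<n. q j \<le> r j \<and> r j \<le> q j + 1) \<and>
           (\<forall>j<n. q j \<le> s j \<and> s j \<le> q j + 1) \<and> l (g r) i \<noteq> l (g s) i"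
  proof (rule kuhn_lemma[of p n "\<lambda>z. l (g z)"])
    show "0 < p" by fact
    show "\<forall>z. (\<forall>i<n. z i \<le> p) \<longrightarrow> (\<forall>i<n. l (g z) i = 0 \<or> l (g z) i = 1)"
      using l1 by (metis One_nat_def le_SucE le_zero_eq)
    show "\<forall>z. (\<forall>i<n. z i \<le> p) \<longrightarrow> (\<forall>i<n. z i = 0 \<longrightarrow> l (g z) i = 0)"
      using l2 g by (simp add: g_def)
    show "\<forall>z. (\<forall>i<n. z i \<le> p) \<longrightarrow> (\<forall>i<n. z i = p \<longrightarrow> l (g z) i = 1)"
      using l3 g \<open>0 < p\<close> by (simp add: g_def)
  qed blast
  have near: "\<bar>g r j - g q j\<bar> \<le> 1 / real p" if "\<forall>j<n. q j \<le> r j \<and> r j \<le> q j + 1" for r j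
  proof (cases "j < n")
    case True
    then have "real (q j) \<le> real (r j)" "real (r j) \<le> real (q j) + 1"
      using that by (auto simp flip: of_nat_Suc)
    then show ?thesis
      using True \<open>0 < p\<close> by (simp add: g_def divide_simps abs_if)
  qed (simp add: g_def)
  show thesis
  proof (rule that[of "g q"])
    show "g q \<in> unit_cube n"
      using g q by (meson less_imp_le)
    fix i assume i: "i < n"
    with rs obtain r s where r: "\<forall>j<n. q j \<le> r j \<and> r j \<le> q j + 1"
      and s: "\<forall>j<n. q j \<le> s j \<and> s j \<le> q j + 1" and ne: "l (g r) i \<noteq> l (g s) i"
      by blast
    \<comment> \<open>Since \<open>q j < p\<close> is strict, vertices with entries
      \<open>q j + 1\<close> still lie on the grid.\<close>
    have gr: "g r \<in> unit_cube n" and gs: "g s \<in> unit_cube n"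
      using r s q by (auto intro!: g) (metis Suc_leI le_trans)+
    consider "l (g r) i = 0" "l (g s) i = 1" | "l (g r) i = 1" "l (g s) i = 0"
      using ne l1 by (metis One_nat_def le_SucE le_zero_eq)
    then show "\<exists>u\<in>unit_cube n. \<exists>v\<in>unit_cube n.
           (\<forall>j. \<bar>u j - g q j\<bar> \<le> 1 / real p \<and> \<bar>v j - g q j\<bar> \<le> 1 / real p) \<and> u i \<le> F u i \<and> F v i \<le> v i"
    proof cases
      case 1
      then show ?thesis
        using gr gs l4 l5 i near[OF r] near[OF s] by (intro bexI[OF _ gr] bexI[OF _ gs]) auto
    next
      case 2
      then show ?thesis
        using gr gs l4 l5 i near[OF r] near[OF s] by (intro bexI[OF _ gs] bexI[OF _ gr]) auto
    qed
  qed
qed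

text \<open>Let the mesh tend to 0. Along a convergent subsequence of the cell corners, the vertices
  with \<open>u i \<le> F u i\<close> and those with \<open>F v i \<le> v i\<close> tend to the same
  point, so continuity turns the two inequalities into an equality.\<close>

theorem brouwer_unit_cube:
  assumes cont: "continuous_on (unit_cube n) F" and F: "F ` unit_cube n \<subseteq> unit_cube n"
  shows "\<exists>x\<in>unit_cube n. F x = x"
proof -
  have "\<exists>x. x \<in> unit_cube n \<and> (\<forall>i<n. \<exists>u\<in>unit_cube n. \<exists>v\<in>unit_cube n.
           (\<forall>j. \<bar>u j - x j\<bar> \<le> 1 / real (Suc m) \<and> \<bar>v j - x j\<bar> \<le> 1 / real (Suc m)) \<and>
           u i \<le> F u i \<and> F v i \<le> v i)" for m
    using kuhn_grid_point[OF F, of "Suc m"] by (metis zero_less_Suc)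
  then obtain X where X: "\<And>m. X m \<in> unit_cube n"
    and XUV: "\<And>m i. i < n \<Longrightarrow> \<exists>u\<in>unit_cube n. \<exists>v\<in>unit_cube n.
           (\<forall>j. \<bar>u j - X m j\<bar> \<le> 1 / real (Suc m) \<and> \<bar>v j - X m j\<bar> \<le> 1 / real (Suc m)) \<and>
           u i \<le> F u i \<and> F v i \<le> v i"
    by metis
  obtain x r where x: "x \<in> unit_cube n" and r: "strict_mono (r::nat\<Rightarrow>nat)" and Xr: "(X \<circ> r) \<longlonglongrightarrow> x"
    using compact_unit_cube[of n] X unfolding compact_eq_seq_compact_metric seq_compact_def by metis
  have near: "W \<longlonglongrightarrow> x" if "\<And>m j. \<bar>W m j - X (r m) j\<bar> \<le> 1 / real (Suc (r m))" for W
    unfolding LIMSEQ_coordinatewise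
  proof
    fix j
    have "(\<lambda>m. 1 / real (Suc (r m))) \<longlonglongrightarrow> 0"
      using LIMSEQ_subseq_LIMSEQ[OF LIMSEQ_inverse_real_of_nat r] by (simp add: o_def inverse_eq_divide)
    then have "(\<lambda>m. W m j - X (r m) j) \<longlonglongrightarrow> 0"
      by (rule Lim_null_comparison[rotated]) (use that in auto)
    moreover have "(\<lambda>m. X (r m) j) \<longlonglongrightarrow> x j"
      using Xr by (simp add: LIMSEQ_coordinatewise)
    ultimately show "(\<lambda>m. W m j) \<longlonglongrightarrow> x j"
      using tendsto_add by fastforce
  qed
  have Flim: "(\<lambda>m. F (W m) i) \<longlonglongrightarrow> F x i" if "W \<longlonglongrightarrow> x" "\<And>m. W m \<in> unit_cube n" for W i
    using continuous_on_tendsto_compose[OF cont that(1) x] that(2) by (simp add: LIMSEQ_coordinatewise)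
  have "F x i = x i" if i: "i < n" for i
  proof -
    have "\<forall>m. \<exists>u v. u \<in> unit_cube n \<and> v \<in> unit_cube n \<and>
        (\<forall>j. \<bar>u j - X (r m) j\<bar> \<le> 1 / real (Suc (r m)) \<and> \<bar>v j - X (r m) j\<bar> \<le> 1 / real (Suc (r m))) \<and>
        u i \<le> F u i \<and> F v i \<le> v i"
      using XUV[OF i] by blast
    then obtain U V where U: "\<And>m. U m \<in> unit_cube n" and V: "\<And>m. V m \<in> unit_cube n"
      and UX: "\<And>m j. \<bar>U m j - X (r m) j\<bar> \<le> 1 / real (Suc (r m))"
      and VX: "\<And>m j. \<bar>V m j - X (r m) j\<bar> \<le> 1 / real (Suc (r m))"
      and UF: "\<And>m. U m i \<le> F (U m) i" and VF: "\<And>m. F (V m) i \<le> V m i"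
      by metis
    have Ul: "U \<longlonglongrightarrow> x" and Vl: "V \<longlonglongrightarrow> x"
      using near UX VX by blast+
    have "x i \<le> F x i"
      using LIMSEQ_le[OF Ul[unfolded LIMSEQ_coordinatewise, rule_format, of i] Flim[OF Ul U]] UF by blast
    moreover have "F x i \<le> x i"
      using LIMSEQ_le[OF Flim[OF Vl V] Vl[unfolded LIMSEQ_coordinatewise, rule_format, of i]] VF by blast
    ultimately show ?thesis by simp
  qed
  moreover have "F x i = x i" if "\<not> i < n" for i
  proof -
    have "F x \<in> unit_cube n" using F x by blast
    then show ?thesis using x that by (simp add: unit_cube_def)
  qed
  ultimately show ?thesis using x by blast
qed

section \<open>Schauder's theorem\<close>

text \<open>Schauder projection: \<open>Y\<close> is a finite \<open>e\<close>-net of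
  \<open>K\<close>, and a point of \<open>K\<close> is approximated by the average of the net points
  near it. Brouwer's theorem is applied to the vector of averaging coefficients, which ranges over a
  cube with one coordinate per net point.\<close>

lemma schauder_approx:
  fixes f :: "'a::real_normed_vector \<Rightarrow> 'a"
  assumes "convex C" "C \<noteq> {}" "continuous_on C f" "f ` C \<subseteq> K" "compact K" "K \<subseteq> C" "0 < e"
  shows "\<exists>x\<in>C. norm (f x - x) \<le> e"
proof -
  obtain Y where Y: "finite Y" "Y \<subseteq> K" and KY: "K \<subseteq> (\<Union>y\<in>Y. ball y e)"
    using \<open>compact K\<close> \<open>0 < e\<close> using seq_compact_imp_totally_bounded[of K] by (auto simp: compact_eq_seq_compact_metric)
  obtain y0 where y0: "y0 \<in> C" using \<open>C \<noteq> {}\<close> by blast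
  define n where "n = card Y"
  obtain y where y: "bij_betw y {..<n} Y"
    using ex_bij_betw_nat_finite[OF Y(1)] by (auto simp: n_def atLeast0LessThan)
  have yK: "y i \<in> K" and yC: "y i \<in> C" if "i < n" for i
    using y Y \<open>K \<subseteq> C\<close> that by (auto simp: bij_betw_def)
  \<comment> \<open>\<open>w x i\<close> is continuous in \<open>x\<close> and positive exactly when
    \<open>y i\<close> is closer to \<open>x\<close> than \<open>e\<close>; the net property makes
    the sum of the weights positive on \<open>K\<close>.\<close>
  define w where "w x i = max 0 (e - dist (y i) x)" for x i
  have w_sum: "0 < (\<Sum>i<n. w x i)" if "x \<in> K" for x
  proof -
    obtain z where "z \<in> Y" "dist z x < e"
      using KY \<open>x \<in> K\<close> unfolding subset_iff UN_iff mem_ball by blast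
    then obtain i where "i < n" "dist (y i) x < e"
      using y by (auto simp: bij_betw_def)
    then show ?thesis
      by (intro sum_pos2[of _ i]) (auto simp: w_def)
  qed
  \<comment> \<open>Dividing by \<open>mx c\<close> scales the total weight down to 1 when it
    exceeds 1 and changes nothing otherwise; the denominator never vanishes.\<close>
  define mx where "mx c = max 1 (\<Sum>i<n. c i)" for c :: "nat \<Rightarrow> real"
  have mx: "1 \<le> mx c" "(\<Sum>i<n. c i) \<le> mx c" for c
    by (auto simp: mx_def)
  \<comment> \<open>The missing weight is put on \<open>y0\<close> so that every point of the cube has an image in \<open>C\<close>.\<close>
  define h where "h c = (\<Sum>i<n. (c i / mx c) *\<^sub>R y i) + (1 - (\<Sum>i<n. c i / mx c)) *\<^sub>R y0" for c
  have hC: "h c \<in> C" if "c \<in> unit_cube n" for c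
  proof -
    let ?d = "\<lambda>i. if i < n then c i / mx c else 1 - (\<Sum>i<n. c i / mx c)"
    let ?z = "\<lambda>i. if i < n then y i else y0"
    have "(\<Sum>i\<in>{..<Suc n}. ?d i *\<^sub>R ?z i) \<in> C"
    proof (rule convex_sum)
      show "(\<Sum>i<Suc n. ?d i) = 1" by simp
      fix i assume "i \<in> {..<Suc n}"
      have "(\<Sum>i<n. c i) / mx c \<le> 1"
        using mx[of c] by (simp add: divide_simps)
      then show "0 \<le> ?d i"
        using that mx(1)[of c] by (auto simp: unit_cube_def sum_divide_distrib intro!: divide_nonneg_pos)
      show "?z i \<in> C" using yC y0 by simp
    qed (use \<open>convex C\<close> in auto)
    then show ?thesis by (simp add: h_def)
  qed
  define F where "F c i = (if i < n then w (f (h c)) i / (\<Sum>j<n. w (f (h c)) j) else 0)" for c i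
  have fK: "f (h c) \<in> K" if "c \<in> unit_cube n" for c
    using hC[OF that] \<open>f ` C \<subseteq> K\<close> by blast
  have coord: "continuous_on S (\<lambda>c. c i)" for S and i :: nat
    by (rule continuous_on_subset[OF continuous_on_product_coordinates]) auto
  have "continuous_on (unit_cube n) h"
    unfolding h_def mx_def by (intro continuous_intros coord) auto
  then have fh: "continuous_on (unit_cube n) (\<lambda>c. f (h c))"
    using hC by (intro continuous_on_compose2[OF \<open>continuous_on C f\<close>]) auto
  have "continuous_on (unit_cube n) (\<lambda>c. F c i)" for i
  proof (cases "i < n")
    case True
    have "\<forall>c\<in>unit_cube n. (\<Sum>j<n. w (f (h c)) j) \<noteq> 0"
      using w_sum fK by fastforce
    then show ?thesis
      using True unfolding F_def w_def by (simp, intro continuous_intros fh) auto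
  qed (simp add: F_def)
  then have "continuous_on (unit_cube n) F"
    by (rule continuous_on_coordinatewise_then_product)
  moreover have "F c \<in> unit_cube n" if "c \<in> unit_cube n" for c
  proof (rule unit_cube_memI)
    fix i assume i: "i < n"
    have pos: "0 < (\<Sum>j<n. w (f (h c)) j)" using w_sum fK that by blast
    have "0 \<le> w (f (h c)) i" by (simp add: w_def)
    then show "0 \<le> F c i" using pos i by (simp add: F_def)
    have "w (f (h c)) i \<le> (\<Sum>j<n. w (f (h c)) j)"
      by (rule member_le_sum) (auto simp: w_def i)
    then show "F c i \<le> 1" using pos i by (simp add: F_def)
  qed (simp add: F_def)
  ultimately obtain c where c: "c \<in> unit_cube n" and Fc: "F c = c"
    using brouwer_unit_cube[of n F] by blast
  let ?x = "h c"
  have pos: "0 < (\<Sum>j<n. w (f ?x) j)" using w_sum fK c by blast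
  have c_eq: "c i = w (f ?x) i / (\<Sum>j<n. w (f ?x) j)" if "i < n" for i
    using fun_cong[OF Fc, of i] that by (simp add: F_def)
  \<comment> \<open>The values of \<open>F\<close> are normalised weights, so at the fixed point the
    coefficients sum to 1. Then \<open>mx c\<close> is 1 and \<open>y0\<close> drops out of
    \<open>h c\<close>.\<close>
  have sum1: "(\<Sum>i<n. c i) = 1"
    using pos by (simp add: c_eq flip: sum_divide_distrib)
  have x: "?x = (\<Sum>i<n. c i *\<^sub>R y i)"
    by (simp add: h_def mx_def sum1)
  have c0: "0 \<le> c i" if "i < n" for i
    using c that by (simp add: unit_cube_def)
  \<comment> \<open>The difference is the \<open>c\<close>-average of the vectors
    \<open>f ?x - y i\<close>, and only net points within \<open>e\<close> of \<open>f ?x\<close>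
    carry weight.\<close>
  have "f ?x - ?x = (\<Sum>i<n. c i *\<^sub>R (f ?x - y i))"
    unfolding x[symmetric] scaleR_diff_right sum_subtractf
    by (simp add: x[symmetric] sum1 flip: scaleR_sum_left)
  also have "norm \<dots> \<le> (\<Sum>i<n. c i * e)"
  proof (rule sum_norm_le)
    fix i assume "i \<in> {..<n}"
    then have i: "i < n" by simp
    show "norm (c i *\<^sub>R (f ?x - y i)) \<le> c i * e"
    proof (cases "c i = 0")
      case False
      then have "w (f ?x) i \<noteq> 0" using c_eq[OF i] by auto
      then have "dist (y i) (f ?x) \<le> e" by (auto simp: w_def max_def split: if_splits)
      then show ?thesis
        using c0[OF i] by (simp add: dist_norm norm_minus_commute mult_left_mono)
    qed simp
  qed
  also have "\<dots> = e" by (simp add: sum1 flip: sum_distrib_right)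
  finally show ?thesis using hC[OF c] by blast
qed

text \<open>Take approximate fixed points with errors \<open>1 / Suc n\<close>. Their images have a
  convergent subsequence in \<open>K\<close>; the points themselves have the same limit, which lies
  in \<open>C\<close>, and continuity of \<open>f\<close> there finishes.\<close>

theorem schauder:
  fixes f :: "'a::real_normed_vector \<Rightarrow> 'a"
  assumes C: "convex C" "C \<noteq> {}" and f: "continuous_on C f" "f ` C \<subseteq> K" and K: "compact K" "K \<subseteq> C"
  shows "\<exists>x\<in>C. f x = x"
proof -
  have "\<exists>x\<in>C. norm (f x - x) \<le> 1 / real (Suc n)" for n
    using schauder_approx[OF C f K, of "1 / real (Suc n)"] by simp
  then obtain X where X: "\<And>n. X n \<in> C" and Xn: "\<And>n. norm (f (X n) - X n) \<le> 1 / real (Suc n)"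
    by metis
  have "\<And>n. f (X n) \<in> K" using X f(2) by blast
  then obtain z r where z: "z \<in> K" and r: "strict_mono (r::nat\<Rightarrow>nat)" and fz: "((\<lambda>n. f (X n)) \<circ> r) \<longlonglongrightarrow> z"
    using K(1) unfolding compact_eq_seq_compact_metric seq_compact_def by metis
  have "(\<lambda>n. 1 / real (Suc (r n))) \<longlonglongrightarrow> 0"
    using LIMSEQ_subseq_LIMSEQ[OF LIMSEQ_inverse_real_of_nat r] by (simp add: o_def inverse_eq_divide)
  then have "(\<lambda>n. f (X (r n)) - X (r n)) \<longlonglongrightarrow> 0"
    by (rule Lim_null_comparison[rotated]) (use Xn in auto)
  then have "(\<lambda>n. X (r n)) \<longlonglongrightarrow> z"
    using tendsto_diff[OF fz] by (fastforce simp: o_def)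
  moreover have zC: "z \<in> C" using z K(2) by blast
  ultimately have "(\<lambda>n. f (X (r n))) \<longlonglongrightarrow> f z"
    using X by (intro continuous_on_tendsto_compose[OF f(1)]) auto
  then have "f z = z"
    using fz LIMSEQ_unique by (fastforce simp: o_def)
  with zC show ?thesis by blast
qed

section \<open>Fixed points in an order interval of continuous functions\<close>

text \<open>The retraction of the line onto the unit interval. Composing with it extends a
  continuous function on the interval to a bounded continuous one on the line, an element of a
  normed space to which \<open>schauder\<close> applies.\<close>

abbreviation clamp01 :: "real \<Rightarrow> real" where
  "clamp01 t \<equiv> max 0 (min 1 t)"

lemma bcontfun_clamp01:
  assumes "continuous_on {0..1} (v :: real \<Rightarrow> real)"
  shows "(\<lambda>t. v (clamp01 t)) \<in> bcontfun"
proof -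
  have "continuous_on UNIV (\<lambda>t. v (clamp01 t))"
    by (rule continuous_on_compose2[OF assms]) (auto intro!: continuous_intros)
  moreover have "bounded (v ` {0..1})"
    by (intro compact_imp_bounded compact_continuous_image assms) auto
  then have "bounded (range (\<lambda>t. v (clamp01 t)))"
    by (rule bounded_subset) auto
  ultimately show ?thesis by (simp add: bcontfun_def)
qed

text \<open>Schauder's theorem in the supremum norm: the common Lipschitz constant \<open>L\<close>
  puts the image of the order interval into a set \<open>K\<close> that is compact by Arzela-Ascoli.
  The last assumption is continuity of \<open>T\<close> in this norm.\<close>

theorem fixed_point_order_interval:
  fixes l u :: "real \<Rightarrow> real" and T :: "(real \<Rightarrow> real) \<Rightarrow> real \<Rightarrow> real" and L :: real
  defines "S \<equiv> {v. continuous_on {0..1} v \<and> (\<forall>t\<in>{0..1}. l t \<le> v t \<and> v t \<le> u t)}"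
  assumes l: "l \<in> S" and u: "continuous_on {0..1} u"
    and TS: "\<And>v. v \<in> S \<Longrightarrow> T v \<in> S"
    and lip: "\<And>v s t. v \<in> S \<Longrightarrow> s \<in> {0..1} \<Longrightarrow> t \<in> {0..1} \<Longrightarrow> \<bar>T v s - T v t\<bar> \<le> L * \<bar>s - t\<bar>"
    and cont: "\<And>v e. v \<in> S \<Longrightarrow> 0 < e \<Longrightarrow> \<exists>d>0. \<forall>w\<in>S. (\<forall>t\<in>{0..1}. \<bar>w t - v t\<bar> < d) \<longrightarrow>
             (\<forall>t\<in>{0..1}. \<bar>T w t - T v t\<bar> < e)"
  shows "\<exists>v\<in>S. \<forall>t\<in>{0..1}. T v t = v t"
proof -
  \<comment> \<open>The condition \<open>v (clamp01 t) = v t\<close> makes each element determined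
    by its restriction to the interval, so uniform convergence there is convergence in the normed
    space.\<close>
  define C :: "(real \<Rightarrow>\<^sub>C real) set" where
    "C = {v :: real \<Rightarrow>\<^sub>C real. (\<forall>t. l (clamp01 t) \<le> v t \<and> v t \<le> u (clamp01 t) \<and> v (clamp01 t) = v t)}"
  define K where "K = {v \<in> C. \<forall>s\<in>{0..1}. \<forall>t\<in>{0..1}. \<bar>v s - v t\<bar> \<le> L * \<bar>s - t\<bar>}"
  define E :: "(real \<Rightarrow> real) \<Rightarrow> real \<Rightarrow>\<^sub>C real" where "E v = Bcontfun (\<lambda>t. v (clamp01 t))" for v
  have E: "apply_bcontfun (E v) t = v (clamp01 t)" if "continuous_on {0..1} v" for v t
    using bcontfun_clamp01[OF that] by (simp add: E_def Bcontfun_inverse)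
  have CS: "apply_bcontfun v \<in> S" if "v \<in> C" for v
  proof -
    have "l t \<le> v t \<and> v t \<le> u t" if t: "t \<in> {0..1}" for t
    proof -
      have "l (clamp01 t) \<le> v t \<and> v t \<le> u (clamp01 t)" using \<open>v \<in> C\<close> by (simp add: C_def)
      then show ?thesis using t by simp
    qed
    then show ?thesis by (simp add: S_def)
  qed
  have ES: "E v \<in> C" if "v \<in> S" for v
    using that by (auto simp: C_def E S_def)
  define P where "P v = E (T (apply_bcontfun v))" for v
  have P: "P v t = T v t" if "v \<in> C" "t \<in> {0..1}" for v t
    using TS[OF CS[OF that(1)]] that(2) by (simp add: P_def E S_def)
  have PK: "P v \<in> K" if "v \<in> C" for v
    using lip[OF CS] TS[OF CS] ES that by (simp add: K_def P) (simp add: P_def)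
  have "compact K"
    unfolding compact_eq_seq_compact_metric seq_compact_def
  proof (intro allI impI)
    fix X :: "nat \<Rightarrow> real \<Rightarrow>\<^sub>C real" assume X: "\<forall>n. X n \<in> K"
    obtain Bl Bu where Bl: "\<And>t. t \<in> {0..1} \<Longrightarrow> \<bar>l t\<bar> \<le> Bl" and Bu: "\<And>t. t \<in> {0..1} \<Longrightarrow> \<bar>u t\<bar> \<le> Bu"
    proof -
      have "bounded (l ` {0..1})" "bounded (u ` {0..1})"
        using l u by (auto intro!: compact_imp_bounded compact_continuous_image simp: S_def)
      then obtain A B where "\<forall>x\<in>l ` {0..1}. norm x \<le> A" "\<forall>x\<in>u ` {0..1}. norm x \<le> B"
        unfolding bounded_iff by blast
      then show thesis using that[of A B] by simp
    qed
    have XS: "apply_bcontfun (X n) \<in> S" for n using X CS by (auto simp: K_def)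
    have XL: "\<bar>X n s - X n t\<bar> \<le> L * \<bar>s - t\<bar>" if "s \<in> {0..1}" "t \<in> {0..1}" for n s t
      using X that by (auto simp: K_def)
    obtain g k where g: "continuous_on {0..1} g" and k: "strict_mono (k :: nat \<Rightarrow> nat)"
      and lim: "\<And>e. 0 < e \<Longrightarrow> \<exists>N. \<forall>n x. n \<ge> N \<and> x \<in> {0..1} \<longrightarrow> norm (X (k n) x - g x) < e"
    proof (rule Arzela_Ascoli[of "{0..1::real}" "\<lambda>n. apply_bcontfun (X n)" "max Bl Bu"])
      fix n and t :: real assume t: "t \<in> {0..1}"
      then have "l t \<le> X n t" "X n t \<le> u t" using XS[of n] by (auto simp: S_def)
      then show "norm (X n t) \<le> max Bl Bu" using Bl[OF t] Bu[OF t] by auto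
    next
      fix t e :: real assume t: "t \<in> {0..1}" and e: "0 < e"
      \<comment> \<open>Using \<open>\<bar>L\<bar> + 1\<close> keeps the radius positive whatever
        the sign of \<open>L\<close>.\<close>
      have "\<bar>X n t - X n s\<bar> < e" if s: "s \<in> {0..1}" and "\<bar>t - s\<bar> < e / (\<bar>L\<bar> + 1)" for n s
      proof -
        have "\<bar>X n t - X n s\<bar> \<le> L * \<bar>t - s\<bar>" using XL t s by blast
        also have "\<dots> \<le> (\<bar>L\<bar> + 1) * \<bar>t - s\<bar>" by (intro mult_right_mono) auto
        also have "\<dots> < e" using that(2) by (simp add: field_simps)
        finally show ?thesis .
      qed
      then show "\<exists>d>0. \<forall>n s. s \<in> {0..1} \<and> norm (t - s) < d \<longrightarrow> norm (X n t - X n s) < e"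
        using e by (intro exI[of _ "e / (\<bar>L\<bar> + 1)"]) auto
    qed auto
    have pw: "(\<lambda>n. X (k n) t) \<longlonglongrightarrow> g t" if "t \<in> {0..1}" for t
      unfolding LIMSEQ_iff using lim that by blast
    have gS: "g \<in> S"
      using g LIMSEQ_le_const[OF pw] LIMSEQ_le_const2[OF pw] XS by (auto simp: S_def)
    have "E g \<in> K"
    proof -
      have "\<bar>g s - g t\<bar> \<le> L * \<bar>s - t\<bar>" if "s \<in> {0..1}" "t \<in> {0..1}" for s t
        by (rule LIMSEQ_le_const2[OF tendsto_rabs[OF tendsto_diff[OF pw[OF that(1)] pw[OF that(2)]]]])
          (use XL that in auto)
      then show ?thesis using ES[OF gS] g by (simp add: K_def E)
    qed
    moreover have "(X \<circ> k) \<longlonglongrightarrow> E g"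
    proof (rule uniform_limit_tendsto_bcontfun, rule uniform_limitI)
      fix e :: real assume "0 < e"
      then obtain N where N: "\<And>n t. n \<ge> N \<Longrightarrow> t \<in> {0..1} \<Longrightarrow> norm (X (k n) t - g t) < e"
        using lim by blast
      have "dist (X (k n) t) (E g t) < e" if "n \<ge> N" for n t
      proof -
        have "X (k n) (clamp01 t) = X (k n) t" using X by (auto simp: K_def C_def)
        then show ?thesis using N[OF that, of "clamp01 t"] g by (simp add: E dist_norm)
      qed
      then show "\<forall>\<^sub>F n in sequentially. \<forall>t\<in>UNIV. dist ((X \<circ> k) n t) (E g t) < e"
        unfolding eventually_sequentially by auto
    qed
    ultimately show "\<exists>G\<in>K. \<exists>r. strict_mono r \<and> (X \<circ> r) \<longlonglongrightarrow> G"
      using k by blast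
  qed
  moreover have "convex C"
  proof (rule convexI)
    fix x y :: "real \<Rightarrow>\<^sub>C real" and p q :: real
    assume x: "x \<in> C" and y: "y \<in> C" and pq: "0 \<le> p" "0 \<le> q" "p + q = 1"
    have "l s \<le> p * X + q * Y \<and> p * X + q * Y \<le> u s" if "l s \<le> X" "X \<le> u s" "l s \<le> Y" "Y \<le> u s" for s X Y
      using convex_bound_le[of X "u s" Y p q] convex_bound_le[of "-X" "- l s" "-Y" p q] that pq by simp
    moreover have "p * x t + q * y t = p * x (clamp01 t) + q * y (clamp01 t)" for t
      using x y by (simp add: C_def)
    ultimately show "p *\<^sub>R x + q *\<^sub>R y \<in> C"
      using x y by (simp add: C_def)
  qed
  moreover have "C \<noteq> {}" using ES[OF l] by blast
  moreover have "continuous_on C P"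
    unfolding continuous_on_iff
  proof (intro ballI allI impI)
    fix v and e :: real assume v: "v \<in> C" and "0 < e"
    \<comment> \<open>Half of \<open>e\<close>, because strict pointwise bounds yield only a weak
      bound on the supremum.\<close>
    then obtain d where "d > 0" and d: "\<And>w. w \<in> S \<Longrightarrow> (\<forall>t\<in>{0..1}. \<bar>w t - v t\<bar> < d) \<Longrightarrow>
             (\<forall>t\<in>{0..1}. \<bar>T w t - T v t\<bar> < e / 2)"
      using cont[OF CS[OF v], of "e / 2"] by auto
    have "dist (P w) (P v) < e" if w: "w \<in> C" "dist w v < d" for w
    proof -
      have "\<forall>t\<in>{0..1}. \<bar>T w t - T v t\<bar> < e / 2"
        using d[OF CS[OF w(1)]] dist_fun_lt_imp_dist_val_lt[OF w(2)] by (simp add: dist_real_def)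
      then have "dist (P w t) (P v t) \<le> e / 2" for t
        using TS[OF CS[OF v]] TS[OF CS[OF w(1)]] by (simp add: P_def E S_def dist_real_def less_imp_le)
      then have "dist (P w) (P v) \<le> e / 2" by (rule dist_bound)
      then show ?thesis using \<open>0 < e\<close> by simp
    qed
    then show "\<exists>d>0. \<forall>w\<in>C. dist w v < d \<longrightarrow> dist (P w) (P v) < e"
      using \<open>d > 0\<close> by blast
  qed
  moreover have "K \<subseteq> C" by (auto simp: K_def)
  ultimately obtain v where v: "v \<in> C" "P v = v"
    using schauder[of C P K] PK by blast
  then have "\<forall>t\<in>{0..1}. T v t = v t" using P by metis
  then show ?thesis using CS[OF v(1)] by blast
qed

section \<open>Periodic linear problems\<close>

abbreviation deriv01 :: "(real \<Rightarrow> real) \<Rightarrow> (real \<Rightarrow> real) \<Rightarrow> bool" where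
  "deriv01 u u' \<equiv> \<forall>t\<in>{0..1}. (u has_real_derivative u' t) (at t within {0..1})"

lemma deriv01_continuous: "deriv01 u u' \<Longrightarrow> continuous_on {0..1} u"
  using DERIV_continuous_on by blast

lemma deriv01_nondecreasing:
  assumes u: "deriv01 u u'" and u': "\<And>t. t \<in> {0..1} \<Longrightarrow> 0 \<le> u' t"
    and st: "0 \<le> s" "s \<le> t" "t \<le> 1"
  shows "u s \<le> u t"
proof (rule DERIV_nonneg_imp_increasing_open[OF st(2)])
  fix r assume r: "s < r" "r < t"
  with st u have "(u has_real_derivative u' r) (at r within {0..1})" by simp
  moreover have "at r within {0..1} = at r"
    using r st by (intro at_within_interior) simp
  ultimately show "\<exists>y. DERIV u r :> y \<and> 0 \<le> y"
    using u'[of r] r st by auto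
next
  show "continuous_on {s..t} u"
    using deriv01_continuous[OF u] st by (auto intro: continuous_on_subset)
qed

text \<open>Variation of constants for \<open>u' + k * u = v\<close>; the first summand is the
  initial value forced by \<open>u 0 = u 1\<close>.\<close>

definition periodic_solution :: "real \<Rightarrow> (real \<Rightarrow> real) \<Rightarrow> real \<Rightarrow> real" where
  "periodic_solution k v t = exp (- k * t) *
     (integral {0..1} (\<lambda>s. exp (k * s) * v s) / (exp k - 1) + integral {0..t} (\<lambda>s. exp (k * s) * v s))"

lemma periodic_solution_deriv:
  assumes "continuous_on {0..1} v"
  shows "deriv01 (periodic_solution k v) (\<lambda>t. v t - k * periodic_solution k v t)"
proof
  fix t :: real assume t: "t \<in> {0..1}"
  have I: "((\<lambda>t. integral {0..t} (\<lambda>s. exp (k * s) * v s)) has_real_derivative exp (k * t) * v t)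
      (at t within {0..1})"
    by (rule integral_has_real_derivative[OF _ t]) (intro continuous_intros assms)
  show "(periodic_solution k v has_real_derivative v t - k * periodic_solution k v t) (at t within {0..1})"
    unfolding periodic_solution_def
    by (rule derivative_eq_intros I refl)+ (simp add: algebra_simps exp_minus divide_simps)
qed

lemma periodic_solution_periodic:
  assumes "k \<noteq> 0"
  shows "periodic_solution k v 0 = periodic_solution k v 1"
proof -
  have "exp k - 1 \<noteq> 0" using assms by simp
  then show ?thesis
    by (simp add: periodic_solution_def exp_minus divide_simps) (simp add: algebra_simps)
qed

text \<open>The integrating factor makes \<open>exp (k * t) * u t\<close> nondecreasing, and
  comparing the two ends gives \<open>0 \<le> (exp k - 1) * u 0\<close>. The sign then spreads
  forward from 0 if \<open>k > 0\<close> and backward from 1 if \<open>k < 0\<close>.\<close>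

lemma periodic_sign:
  assumes k: "k \<noteq> 0" and u: "deriv01 u u'" and per: "u 0 = u 1"
    and ge: "\<And>t. t \<in> {0..1} \<Longrightarrow> 0 \<le> u' t + k * u t" and t: "t \<in> {0..1}"
  shows "0 \<le> k * u t"
proof -
  let ?w = "\<lambda>t. exp (k * t) * u t"
  have "deriv01 ?w (\<lambda>t. exp (k * t) * (u' t + k * u t))"
  proof
    fix t :: real assume "t \<in> {0..1}"
    then have "(u has_real_derivative u' t) (at t within {0..1})" using u by blast
    then show "(?w has_real_derivative exp (k * t) * (u' t + k * u t)) (at t within {0..1})"
      by (auto intro!: derivative_eq_intros simp: algebra_simps)
  qed
  then have mono: "?w s \<le> ?w r" if "0 \<le> s" "s \<le> r" "r \<le> 1" for s r
    using deriv01_nondecreasing[of ?w] ge that by simp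
  have "0 \<le> (exp k - 1) * u 0"
    using mono[of 0 1] per by (simp add: algebra_simps)
  show ?thesis
  proof (cases "0 < k")
    case True
    then have "0 \<le> u 0" using \<open>0 \<le> (exp k - 1) * u 0\<close> by (simp add: zero_le_mult_iff)
    moreover have "u 0 \<le> exp (k * t) * u t" using mono[of 0 t] t by simp
    ultimately have "0 \<le> exp (k * t) * u t" by linarith
    then show ?thesis using True by (simp add: zero_le_mult_iff)
  next
    case False
    then have "k < 0" using k by simp
    then have "u 1 \<le> 0" using \<open>0 \<le> (exp k - 1) * u 0\<close> per by (simp add: zero_le_mult_iff)
    moreover have "exp (k * t) * u t \<le> exp k * u 1" using mono[of t 1] t by simp
    ultimately have "exp (k * t) * u t \<le> 0"
      by (meson exp_ge_zero mult_nonneg_nonpos order_trans)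
    then show ?thesis using \<open>k < 0\<close> by (simp add: mult_le_0_iff zero_le_mult_iff)
  qed
qed

text \<open>The constant \<open>M / k\<close> solves the problem with right-hand side
  \<open>M\<close>; \<open>periodic_sign\<close> compares \<open>u\<close> and \<open>- u\<close>
  with it.\<close>

lemma periodic_bound:
  assumes k: "k \<noteq> 0" and u: "deriv01 u u'" and per: "u 0 = u 1"
    and M: "\<And>t. t \<in> {0..1} \<Longrightarrow> \<bar>u' t + k * u t\<bar> \<le> M" and t: "t \<in> {0..1}"
  shows "\<bar>k * u t\<bar> \<le> M"
proof -
  have D: "deriv01 (\<lambda>t. c * u t + M / k) (\<lambda>t. c * u' t)" for c
    using u by (auto intro!: derivative_eq_intros)
  have "0 \<le> k * (c * u t + M / k)" if "c = 1 \<or> c = -1" for c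
  proof (rule periodic_sign[OF k D[of c] _ _ t])
    fix s :: real assume "s \<in> {0..1}"
    from M[OF this] show "0 \<le> c * u' s + k * (c * u s + M / k)"
      using that k by (auto simp: algebra_simps)
  qed (use per in simp)
  from this[of 1] this[of "-1"] show ?thesis
    using k by (simp add: algebra_simps abs_le_iff)
qed

text \<open>By linearity the difference solves the problem with right-hand side
  \<open>w - v\<close>.\<close>

lemma periodic_solution_diff_bound:
  assumes "k \<noteq> 0" "continuous_on {0..1} v" "continuous_on {0..1} w"
    and e: "\<And>t. t \<in> {0..1} \<Longrightarrow> \<bar>w t - v t\<bar> \<le> e" and "t \<in> {0..1}"
  shows "\<bar>k * (periodic_solution k w t - periodic_solution k v t)\<bar> \<le> e"
proof -
  let ?V = "periodic_solution k v" and ?W = "periodic_solution k w"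
  have "deriv01 (\<lambda>t. ?W t - ?V t) (\<lambda>t. (w t - k * ?W t) - (v t - k * ?V t))"
    using periodic_solution_deriv assms(2,3) by (blast intro: DERIV_diff)
  then show ?thesis
    by (rule periodic_bound[OF assms(1)])
      (use assms periodic_solution_periodic[OF assms(1)] in \<open>auto simp: algebra_simps\<close>)
qed

section \<open>The second-order periodic operator: positivity and inversion\<close>

text \<open>For \<open>p + q = - b\<close> and \<open>p * q = - a\<close> the sign assumption is
  \<open>Lx \<ge> 0\<close>. It gives the chain
  \<open>\<phi> 0 t \<le> \<phi> 0 0 = \<phi> 1 1 \<le> \<phi> 1 t\<close>, whose middle equality is
  periodicity; the conclusion is the difference of its ends.\<close>

lemma second_order_positivity:
  fixes p q :: real
  assumes pq: "q < 0" "0 < p" and x: "deriv01 x x'" "deriv01 x' x''"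
    and per: "x 0 = x 1" "x' 0 = x' 1"
    and ge: "\<And>t. t \<in> {0..1} \<Longrightarrow> 0 \<le> - x'' t + (p + q) * x' t - p * q * x t"
    and t: "t \<in> {0..1}"
  shows "0 \<le> (exp p - 1) * (x' t - q * x t) + (1 - exp q) * (x' t - p * x t)"
proof -
  \<comment> \<open>Up to a factor, the derivative of \<open>\<phi> c\<close> is the kernel of the operator \<open>x' + k x\<close> composed with
    the solution operator; \<open>c = 0\<close> and \<open>c = 1\<close> are the two branches of its periodic extension.\<close>
  define \<phi> where "\<phi> c s = exp (p * (t - s + c)) * (x' s - q * x s) - exp (q * (t - s + c)) * (x' s - p * x s)"
    for c s
  have D: "deriv01 (\<lambda>s. - \<phi> c s)
     (\<lambda>s. (exp (p * (t - s + c)) - exp (q * (t - s + c))) * (- x'' s + (p + q) * x' s - p * q * x s))" for c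
  proof
    fix s :: real assume s: "s \<in> {0..1}"
    note [derivative_intros] = x(1)[rule_format, OF s] x(2)[rule_format, OF s]
    show "((\<lambda>s. - \<phi> c s) has_real_derivative
        (exp (p * (t - s + c)) - exp (q * (t - s + c))) * (- x'' s + (p + q) * x' s - p * q * x s))
        (at s within {0..1})"
      unfolding \<phi>_def by (rule derivative_eq_intros refl | simp)+ (simp add: algebra_simps)
  qed
  have kernel: "exp (q * r) \<le> exp (p * r)" if "0 \<le> r" for r
  proof -
    have "q * r \<le> p * r" using pq that by (intro mult_right_mono) auto
    then show ?thesis by simp
  qed
  have "\<phi> 1 1 \<le> \<phi> 1 t"
    using deriv01_nondecreasing[OF D[of 1], of t 1] ge kernel t by simp
  \<comment> \<open>For \<open>c = 0\<close> the kernel has the right sign only where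
    \<open>s \<le> t\<close>, so monotonicity is argued on \<open>{0..t}\<close> alone; for
    \<open>c = 1\<close> it held on the whole interval.\<close>
  moreover have "\<phi> 0 t \<le> \<phi> 0 0"
  proof -
    have "continuous_on {0..t} (\<phi> 0)"
      using continuous_on_minus[OF deriv01_continuous[OF D[of 0]]] t
      by (auto intro: continuous_on_subset)
    moreover have "\<exists>y. DERIV (\<phi> 0) s :> y \<and> y \<le> 0" if s: "0 < s" "s < t" for s
    proof -
      have "at s within {0..1} = at s" using s t by (intro at_within_interior) simp
      then have "DERIV (\<lambda>s. - \<phi> 0 s) s :>
         (exp (p * (t - s + 0)) - exp (q * (t - s + 0))) * (- x'' s + (p + q) * x' s - p * q * x s)"
        using D[of 0, rule_format, of s] s t by simp
      from DERIV_minus[OF this] show ?thesis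
        using ge[of s] kernel[of "t - s"] s t by (intro exI conjI) auto
    qed
    ultimately show ?thesis
      using DERIV_nonpos_imp_decreasing_open[of 0 t "\<phi> 0"] t by auto
  qed
  moreover have "\<phi> 0 0 = \<phi> 1 1" using per by (simp add: \<phi>_def)
  ultimately have "\<phi> 0 t \<le> \<phi> 1 t" by simp
  then show ?thesis by (simp add: \<phi>_def algebra_simps)
qed

text \<open>The operator factors into first-order ones: \<open>y = x' - q * x\<close> solves
  \<open>y' - p * y = - s\<close>, so two first-order periodic problems are solved in turn.\<close>

lemma periodic_resolvent:
  fixes p q k :: real
  assumes pq: "q < 0" "0 < p" and s: "continuous_on {0..1} s"
  defines "y \<equiv> periodic_solution (- p) (\<lambda>t. - s t)"
  defines "x \<equiv> periodic_solution (- q) y"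
  defines "x' \<equiv> \<lambda>t. y t + q * x t"
  shows "deriv01 y (\<lambda>t. p * y t - s t)"
    and "deriv01 x x'" and "deriv01 x' (\<lambda>t. (p + q) * x' t - p * q * x t - s t)"
    and "x 0 = x 1" and "x' 0 = x' 1"
proof -
  show y: "deriv01 y (\<lambda>t. p * y t - s t)"
    using periodic_solution_deriv[of "\<lambda>t. - s t" "- p"] s
    by (simp add: y_def continuous_on_minus algebra_simps)
  show x: "deriv01 x x'"
    using periodic_solution_deriv[OF deriv01_continuous[OF y], of "- q"]
    by (simp add: x_def x'_def)
  have y01: "y 0 = y 1"
    using pq unfolding y_def by (intro periodic_solution_periodic) simp
  show x01: "x 0 = x 1"
    using pq unfolding x_def by (intro periodic_solution_periodic) simp
  show "x' 0 = x' 1" using x01 y01 by (simp add: x'_def)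
  show "deriv01 x' (\<lambda>t. (p + q) * x' t - p * q * x t - s t)"
  proof
    fix t :: real assume t: "t \<in> {0..1}"
    have "(x' has_real_derivative (p * y t - s t) + q * x' t) (at t within {0..1})"
      using DERIV_add[OF y[rule_format, OF t] DERIV_cmult[OF x[rule_format, OF t], of q]]
      by (simp add: x'_def)
    moreover have "(p * y t - s t) + q * x' t = (p + q) * x' t - p * q * x t - s t"
      by (simp add: x'_def algebra_simps)
    ultimately show "(x' has_real_derivative (p + q) * x' t - p * q * x t - s t) (at t within {0..1})"
      by simp
  qed
qed

section \<open>The nonlinear problem between two periodic bounds\<close>

text \<open>The fixed point argument, with both bounds already periodic together with their first
  derivatives. The equation for \<open>k\<close> is what turns
  \<open>second_order_positivity\<close> into a statement about \<open>x' + k * x\<close>.\<close>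

lemma periodic_problem_between:
  fixes g :: "real \<Rightarrow> real \<Rightarrow> real \<Rightarrow> real" and p q k :: real
  assumes pq: "q < 0" "0 < p"
    and k: "0 < k" "k * (exp p - exp q) = - (q * (exp p - 1) + p * (1 - exp q))"
    and g: "continuous_on ({0..1} \<times> UNIV \<times> UNIV) (\<lambda>(t, x, y). g t x y)"
    and A: "deriv01 A A1" "deriv01 A1 A2" "continuous_on {0..1} A2" "A 0 = A 1" "A1 0 = A1 1"
    and B: "deriv01 B B1" "deriv01 B1 B2" "continuous_on {0..1} B2" "B 0 = B 1" "B1 0 = B1 1"
    and AB: "\<And>t. t \<in> {0..1} \<Longrightarrow>
      - A2 t + (p + q) * A1 t - p * q * A t \<le> - B2 t + (p + q) * B1 t - p * q * B t"
    and between: "\<And>\<eta> \<eta>' t. \<lbrakk>deriv01 \<eta> \<eta>'; continuous_on {0..1} \<eta>';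
        \<And>t. t \<in> {0..1} \<Longrightarrow> A t \<le> \<eta> t \<and> \<eta> t \<le> B t \<and>
          A1 t + k * A t \<le> \<eta>' t + k * \<eta> t \<and> \<eta>' t + k * \<eta> t \<le> B1 t + k * B t;
        t \<in> {0..1}\<rbrakk> \<Longrightarrow>
        - A2 t + (p + q) * A1 t - p * q * A t \<le> g t (\<eta> t) (\<eta>' t) \<and>
        g t (\<eta> t) (\<eta>' t) \<le> - B2 t + (p + q) * B1 t - p * q * B t"
  shows "\<exists>x x'. deriv01 x x' \<and> deriv01 x' (\<lambda>t. (p + q) * x' t - p * q * x t - g t (x t) (x' t)) \<and>
     x 0 = x 1 \<and> x' 0 = x' 1 \<and>
     (\<forall>t\<in>{0..1}. A t \<le> x t \<and> x t \<le> B t \<and>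
          A1 t + k * A t \<le> x' t + k * x t \<and> x' t + k * x t \<le> B1 t + k * B t)"
proof -
  define LA where "LA t = - A2 t + (p + q) * A1 t - p * q * A t" for t
  define LB where "LB t = - B2 t + (p + q) * B1 t - p * q * B t" for t
  have pos: "0 \<le> x' t + k * x t"
    if x: "deriv01 x x'" "deriv01 x' x''" "x 0 = x 1" "x' 0 = x' 1"
      and ge: "\<And>t. t \<in> {0..1} \<Longrightarrow> 0 \<le> - x'' t + (p + q) * x' t - p * q * x t"
      and t: "t \<in> {0..1}" for x x' x'' t
  proof -
    have "0 \<le> (exp p - 1) * (x' t - q * x t) + (1 - exp q) * (x' t - p * x t)"
      using second_order_positivity[OF pq x ge t] .
    also have "\<dots> = (exp p - exp q) * x' t - (q * (exp p - 1) + p * (1 - exp q)) * x t"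
      by (simp add: algebra_simps)
    also have "\<dots> = (exp p - exp q) * x' t + (k * (exp p - exp q)) * x t"
      unfolding k(2) by (simp add: algebra_simps)
    also have "\<dots> = (exp p - exp q) * (x' t + k * x t)"
      by (simp add: algebra_simps)
    finally show ?thesis using pq by (simp add: zero_le_mult_iff)
  qed
  have diff: "deriv01 (\<lambda>t. v t - u t) (\<lambda>t. v' t - u' t)" if "deriv01 u u'" "deriv01 v v'" for u u' v v'
    using that by (blast intro: DERIV_diff)
  define l where "l t = A1 t + k * A t" for t
  define u where "u t = B1 t + k * B t" for t
  define S where "S = {v. continuous_on {0..1} v \<and> (\<forall>t\<in>{0..1}. l t \<le> v t \<and> v t \<le> u t)}"
  have contA: "continuous_on {0..1} A" "continuous_on {0..1} A1"
    and contB: "continuous_on {0..1} B" "continuous_on {0..1} B1"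
    using A B deriv01_continuous by blast+
  have l: "continuous_on {0..1} l" and u: "continuous_on {0..1} u"
    unfolding l_def u_def by (intro continuous_intros contA contB)+
  \<comment> \<open>The order of the bounds comes from positivity applied to \<open>B - A\<close>;
    it puts \<open>l\<close> into \<open>S\<close>.\<close>
  have "l t \<le> u t" if "t \<in> {0..1}" for t
    using pos[OF diff[OF A(1) B(1)] diff[OF A(2) B(2)] _ _ _ that] A(4,5) B(4,5) AB
    by (simp add: l_def u_def algebra_simps)
  then have lS: "l \<in> S" using l by (simp add: S_def)
  define \<eta> where "\<eta> = periodic_solution k"
  \<comment> \<open>The derivative is read off from the equation
    \<open>\<eta>' + k * \<eta> = v\<close>.\<close>
  define \<eta>' where "\<eta>' v t = v t - k * \<eta> v t" for v t
  have \<eta>: "deriv01 (\<eta> v) (\<eta>' v)" "continuous_on {0..1} (\<eta> v)" "continuous_on {0..1} (\<eta>' v)"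
    "\<eta> v 0 = \<eta> v 1" if "v \<in> S" for v
  proof -
    have v: "continuous_on {0..1} v" using that by (simp add: S_def)
    show D: "deriv01 (\<eta> v) (\<eta>' v)"
      using periodic_solution_deriv[OF v, of k] by (simp add: \<eta>_def \<eta>'_def)
    show c: "continuous_on {0..1} (\<eta> v)" using deriv01_continuous[OF D] .
    show "continuous_on {0..1} (\<eta>' v)" unfolding \<eta>'_def by (intro continuous_intros v c)
    show "\<eta> v 0 = \<eta> v 1" using k(1) by (simp add: \<eta>_def periodic_solution_periodic)
  qed
  have first_nonneg: "0 \<le> x t" if "deriv01 x x'" "x 0 = x 1" "\<And>t. t \<in> {0..1} \<Longrightarrow> 0 \<le> x' t + k * x t"
    "t \<in> {0..1}" for x x' t
    using periodic_sign[OF _ that] k(1) by (simp add: zero_le_mult_iff)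
  \<comment> \<open>Membership in \<open>S\<close> bounds \<open>\<eta>' + k * \<eta>\<close>;
    first-order comparison then yields \<open>A \<le> \<eta> \<le> B\<close>, so
    \<open>between\<close> applies to \<open>\<eta> v\<close>.\<close>
  have \<eta>_between: "A t \<le> \<eta> v t \<and> \<eta> v t \<le> B t \<and>
      A1 t + k * A t \<le> \<eta>' v t + k * \<eta> v t \<and> \<eta>' v t + k * \<eta> v t \<le> B1 t + k * B t"
    if v: "v \<in> S" and t: "t \<in> {0..1}" for v t
  proof -
    have ineq: "A1 r + k * A r \<le> \<eta>' v r + k * \<eta> v r" "\<eta>' v r + k * \<eta> v r \<le> B1 r + k * B r"
      if "r \<in> {0..1}" for r
      using v that by (auto simp: S_def l_def u_def \<eta>'_def)
    have "0 \<le> \<eta> v t - A t"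
      by (rule first_nonneg[OF diff[OF A(1) \<eta>(1)[OF v]] _ _ t])
        (use ineq \<eta>(4)[OF v] A(4) in \<open>auto simp: algebra_simps\<close>)
    moreover have "0 \<le> B t - \<eta> v t"
      by (rule first_nonneg[OF diff[OF \<eta>(1)[OF v] B(1)] _ _ t])
        (use ineq \<eta>(4)[OF v] B(4) in \<open>auto simp: algebra_simps\<close>)
    ultimately show ?thesis using ineq[OF t] by simp
  qed
  define s where "s v t = g t (\<eta> v t) (\<eta>' v t)" for v t
  have s_between: "LA t \<le> s v t \<and> s v t \<le> LB t" if "v \<in> S" "t \<in> {0..1}" for v t
    unfolding s_def LA_def LB_def
    using between[OF \<eta>(1)[OF that(1)] \<eta>(3)[OF that(1)] \<eta>_between[OF that(1)] that(2)] .
  have s_cont: "continuous_on {0..1} (s v)" if "v \<in> S" for v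
  proof -
    have "continuous_on {0..1} (\<lambda>t. (\<lambda>(t, x, y). g t x y) (t, \<eta> v t, \<eta>' v t))"
      by (rule continuous_on_compose2[OF g]) (auto intro!: continuous_intros \<eta>[OF that])
    then show ?thesis by (simp add: s_def[abs_def])
  qed
  define y where "y v = periodic_solution (- p) (\<lambda>t. - s v t)" for v
  define x where "x v = periodic_solution (- q) (y v)" for v
  define x' where "x' v t = y v t + q * x v t" for v t
  note res = periodic_resolvent[OF pq s_cont, folded y_def, folded x_def, folded x'_def]
  define T where "T v t = x' v t + k * x v t" for v t
  have T_between: "l t \<le> T v t \<and> T v t \<le> u t" if v: "v \<in> S" and t: "t \<in> {0..1}" for v t
  proof -
    have "0 \<le> (x' v t - A1 t) + k * (x v t - A t)"
      by (rule pos[OF diff[OF A(1) res(2)[OF v]] diff[OF A(2) res(3)[OF v]] _ _ _ t])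
        (use res[OF v] A(4,5) s_between[OF v] in \<open>auto simp: LA_def algebra_simps\<close>)
    moreover have "0 \<le> (B1 t - x' v t) + k * (B t - x v t)"
      by (rule pos[OF diff[OF res(2)[OF v] B(1)] diff[OF res(3)[OF v] B(2)] _ _ _ t])
        (use res[OF v] B(4,5) s_between[OF v] in \<open>auto simp: LB_def algebra_simps\<close>)
    ultimately show ?thesis by (simp add: T_def l_def u_def algebra_simps)
  qed
  have T_deriv: "deriv01 (T v) (\<lambda>t. (p * y v t - s v t) + (q + k) * x' v t)" if v: "v \<in> S" for v
  proof
    fix t :: real assume t: "t \<in> {0..1}"
    have T_eq: "T v = (\<lambda>t. y v t + (q + k) * x v t)"
      by (simp add: T_def x'_def fun_eq_iff algebra_simps)
    show "(T v has_real_derivative (p * y v t - s v t) + (q + k) * x' v t) (at t within {0..1})"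
      unfolding T_eq by (intro DERIV_add DERIV_cmult res(1)[OF v, rule_format, OF t] res(2)[OF v, rule_format, OF t])
  qed
  have TS: "T v \<in> S" if "v \<in> S" for v
    using T_between[OF that] deriv01_continuous[OF T_deriv[OF that]] by (simp add: S_def)
  obtain M where M: "\<And>v t. v \<in> S \<Longrightarrow> t \<in> {0..1} \<Longrightarrow> \<bar>s v t\<bar> \<le> M"
  proof -
    have "continuous_on {0..1} LA" "continuous_on {0..1} LB"
      unfolding LA_def LB_def by (intro continuous_intros contA contB A(3) B(3))+
    then have "bounded (LA ` {0..1})" "bounded (LB ` {0..1})"
      by (auto intro!: compact_imp_bounded compact_continuous_image)
    then obtain a b where "\<forall>x\<in>LA ` {0..1}. norm x \<le> a" "\<forall>x\<in>LB ` {0..1}. norm x \<le> b"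
      unfolding bounded_iff by blast
    then have ab: "\<bar>LA t\<bar> \<le> a" "\<bar>LB t\<bar> \<le> b" if "t \<in> {0..1}" for t using that by auto
    have "\<bar>s v t\<bar> \<le> max a b" if "v \<in> S" "t \<in> {0..1}" for v t
      using s_between[OF that] ab[OF that(2)] by linarith
    then show thesis by (rule that)
  qed
  \<comment> \<open>Bounds the derivative \<open>p * y - s + (q + k) * x'\<close> of
    \<open>T v\<close>: the terms \<open>p * y\<close> and \<open>s\<close> are each at most
    \<open>M\<close>, and \<open>x' = y + q * x\<close> with both summands at most
    \<open>M / p\<close>.\<close>
  define L where "L = 2 * M + \<bar>q + k\<bar> * (2 * (M / p))"
  have T_lip: "\<bar>T v r - T v t\<bar> \<le> L * \<bar>r - t\<bar>" if v: "v \<in> S" and rt: "r \<in> {0..1}" "t \<in> {0..1}" for v r t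
  proof -
    have "\<bar>(p * y v t - s v t) + (q + k) * x' v t\<bar> \<le> L" if t: "t \<in> {0..1}" for t
    proof -
      have y: "\<bar>p * y v t\<bar> \<le> M" if "t \<in> {0..1}" for t
        using periodic_bound[of "- p" "y v" "\<lambda>t. p * y v t - s v t" M t] res(1)[OF v] M[OF v] pq(2) that
          periodic_solution_periodic[of "- p" "\<lambda>t. - s v t"]
        by (simp add: y_def)
      then have y': "\<bar>y v t\<bar> \<le> M / p" if "t \<in> {0..1}" for t
        using that pq by (simp add: abs_mult field_simps)
      have "\<bar>q * x v t\<bar> \<le> M / p"
        using periodic_bound[of "- q" "x v" "x' v" "M / p" t] res(2,4)[OF v] y' pq(1) t
        by (simp add: x'_def)
      then have "\<bar>x' v t\<bar> \<le> 2 * (M / p)"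
        using y'[OF t] by (simp add: x'_def)
      then have "\<bar>(q + k) * x' v t\<bar> \<le> \<bar>q + k\<bar> * (2 * (M / p))"
        unfolding abs_mult by (rule mult_left_mono) simp
      then show ?thesis
        using y[OF t] M[OF v t] unfolding L_def by linarith
    qed
    then have "norm (T v r - T v t) \<le> L * norm (r - t)"
      using T_deriv[OF v] rt by (intro field_differentiable_bound[of "{0..1}"]) auto
    then show ?thesis by simp
  qed
  have T_cont: "\<exists>d>0. \<forall>w\<in>S. (\<forall>t\<in>{0..1}. \<bar>w t - v t\<bar> < d) \<longrightarrow> (\<forall>t\<in>{0..1}. \<bar>T w t - T v t\<bar> < e)"
    if v: "v \<in> S" and e: "0 < e" for v e
  proof -
    \<comment> \<open>If the right-hand sides \<open>s\<close> differ by at most \<open>e'\<close>,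
      then \<open>y\<close> changes by at most \<open>e' / p\<close> and \<open>x\<close> by at most
      \<open>e' / p / \<bar>q\<bar>\<close>, hence \<open>T v\<close> by at most
      \<open>c * e'\<close>.\<close>
    define c where "c = 1 / p + \<bar>q + k\<bar> * (1 / p / \<bar>q\<bar>)"
    have c: "0 < c"
      unfolding c_def using pq by (intro add_pos_nonneg mult_nonneg_nonneg divide_nonneg_nonneg) simp_all
    define e' where "e' = e / (2 * c)"
    have e': "0 < e'" using e c by (simp add: e'_def)
    obtain R where R: "\<And>w t. w \<in> S \<Longrightarrow> t \<in> {0..1} \<Longrightarrow> \<bar>w t\<bar> \<le> R"
    proof -
      have "bounded (l ` {0..1})" "bounded (u ` {0..1})"
        using l u by (auto intro!: compact_imp_bounded compact_continuous_image)
      then obtain a b where "\<forall>x\<in>l ` {0..1}. norm x \<le> a" "\<forall>x\<in>u ` {0..1}. norm x \<le> b"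
        unfolding bounded_iff by blast
      then have ab: "\<bar>l t\<bar> \<le> a" "\<bar>u t\<bar> \<le> b" if "t \<in> {0..1}" for t using that by auto
      have "\<bar>w t\<bar> \<le> max a b" if "w \<in> S" "t \<in> {0..1}" for w t
      proof -
        have "l t \<le> w t" "w t \<le> u t" using that by (auto simp: S_def)
        then show ?thesis using ab[OF that(2)] by linarith
      qed
      then show thesis by (rule that)
    qed
    \<comment> \<open>A compact box holding all arguments of \<open>g\<close>:
      \<open>\<bar>w\<bar> \<le> R\<close> gives \<open>\<bar>k * \<eta>\<bar> \<le> R\<close>, and
      \<open>\<eta>' = w - k * \<eta>\<close>. On it \<open>g\<close> is uniformly
      continuous.\<close>
    let ?Q = "{0..1} \<times> {- (R / k)..R / k} \<times> {- (2 * R)..2 * R}"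
    have Q: "(t, \<eta> w t, \<eta>' w t) \<in> ?Q" if w: "w \<in> S" and t: "t \<in> {0..1}" for w t
    proof -
      have "\<bar>k * \<eta> w t\<bar> \<le> R"
        using periodic_bound[of k "\<eta> w" "\<eta>' w" R t] \<eta>[OF w] R[OF w] k(1) t by (simp add: \<eta>'_def)
      moreover from this have "\<bar>\<eta> w t\<bar> \<le> R / k" using k(1) by (simp add: abs_mult field_simps)
      ultimately show ?thesis using R[OF w t] t by (auto simp: \<eta>'_def abs_le_iff)
    qed
    have "uniformly_continuous_on ?Q (\<lambda>(t, x, y). g t x y)"
      by (intro compact_uniformly_continuous continuous_on_subset[OF g] compact_Times) auto
    then obtain d0 where d0: "0 < d0"
      and unif: "\<And>z z'. z \<in> ?Q \<Longrightarrow> z' \<in> ?Q \<Longrightarrow> dist z' z < d0 \<Longrightarrow>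
         dist ((\<lambda>(t, x, y). g t x y) z') ((\<lambda>(t, x, y). g t x y) z) < e'"
      unfolding uniformly_continuous_on_def using e' by metis
    \<comment> \<open>Changing \<open>v\<close> by less than \<open>d\<close> moves
      \<open>\<eta>\<close> by at most \<open>d / k\<close> and \<open>\<eta>'\<close> by at most
      \<open>2 * d\<close>, together at most \<open>d0 / 2\<close>.\<close>
    define d where "d = d0 / (1 / k + 2) / 2"
    have k2: "0 < 1 / k + 2" using k(1) by (intro add_pos_pos) simp_all
    have d: "0 < d" unfolding d_def using d0 k2 by (intro divide_pos_pos) simp_all
    have "\<bar>T w t - T v t\<bar> < e" if w: "w \<in> S" and wv: "\<forall>t\<in>{0..1}. \<bar>w t - v t\<bar> < d" and t: "t \<in> {0..1}" for w t
    proof -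
      have sd: "\<bar>s w t - s v t\<bar> \<le> e'" if t: "t \<in> {0..1}" for t
      proof -
        have k\<eta>: "\<bar>k * (\<eta> w t - \<eta> v t)\<bar> \<le> d"
          unfolding \<eta>_def using v w wv k(1) t
          by (intro periodic_solution_diff_bound) (auto simp: S_def less_imp_le)
        then have 1: "\<bar>\<eta> w t - \<eta> v t\<bar> \<le> d / k" using k(1) by (simp add: abs_mult pos_le_divide_eq mult.commute)
        have 2: "\<bar>\<eta>' w t - \<eta>' v t\<bar> \<le> 2 * d"
          using k\<eta> wv[rule_format, OF t] unfolding \<eta>'_def right_diff_distrib by linarith
        have "dist (t, \<eta> w t, \<eta>' w t) (t, \<eta> v t, \<eta>' v t) \<le> \<bar>\<eta> w t - \<eta> v t\<bar> + \<bar>\<eta>' w t - \<eta>' v t\<bar>"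
          by (simp add: dist_Pair_Pair dist_real_def sqrt_sum_squares_le_sum_abs)
        also have "\<dots> \<le> d * (1 / k + 2)" using 1 2 by (simp add: algebra_simps)
        also have "\<dots> = d0 / 2" using less_imp_neq[OF k2] unfolding d_def by (simp only: times_divide_eq_left nonzero_divide_eq_eq[OF less_imp_neq[OF k2, symmetric]]) simp
        also have "\<dots> < d0" using d0 by simp
        finally show ?thesis
          using unif[OF Q[OF v t] Q[OF w t]] by (simp add: s_def dist_real_def)
      qed
      have yd: "\<bar>y w t - y v t\<bar> \<le> e' / p" if "t \<in> {0..1}" for t
      proof -
        have "\<bar>- p * (y w t - y v t)\<bar> \<le> e'"
          unfolding y_def
        proof (rule periodic_solution_diff_bound)
          fix r :: real assume "r \<in> {0..1}"
          then show "\<bar>- s w r - - s v r\<bar> \<le> e'" using sd[of r] by simp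
        qed (use pq s_cont v w that in \<open>auto intro!: continuous_on_minus\<close>)
        then show ?thesis using pq by (simp add: abs_mult pos_le_divide_eq mult.commute)
      qed
      have "\<bar>- q * (x w t - x v t)\<bar> \<le> e' / p"
        unfolding x_def
        by (rule periodic_solution_diff_bound)
          (use pq yd t deriv01_continuous[OF res(1)[OF v]] deriv01_continuous[OF res(1)[OF w]] in auto)
      then have "\<bar>x w t - x v t\<bar> * \<bar>q\<bar> \<le> e' / p"
        by (simp only: abs_mult abs_minus_cancel mult.commute)
      then have xd: "\<bar>x w t - x v t\<bar> \<le> e' / p / \<bar>q\<bar>"
        by (rule iffD2[OF pos_le_divide_eq, rotated]) (use pq in simp)
      have "T w t - T v t = (y w t - y v t) + (q + k) * (x w t - x v t)"
        by (simp add: T_def x'_def algebra_simps)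
      also have "\<bar>\<dots>\<bar> \<le> e' / p + \<bar>q + k\<bar> * (e' / p / \<bar>q\<bar>)"
        using yd[OF t] mult_left_mono[OF xd, of "\<bar>q + k\<bar>"] by (simp only: abs_mult[symmetric]) linarith
      also have "\<dots> = e' * c" by (simp add: c_def algebra_simps)
      also have "\<dots> < e" using c e by (simp add: e'_def)
      finally show ?thesis .
    qed
    then show ?thesis using d by blast
  qed
  obtain v where v: "v \<in> S" and fixed: "\<And>t. t \<in> {0..1} \<Longrightarrow> T v t = v t"
    using fixed_point_order_interval[of l u T L, folded S_def] lS u TS T_lip T_cont by blast
  \<comment> \<open>Both \<open>x v\<close> and \<open>\<eta> v\<close> are periodic solutions of
    \<open>u' + k * u = v\<close>, hence equal. So \<open>s v\<close> is \<open>g\<close> evaluated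
    along \<open>x v\<close> itself.\<close>
  have "\<bar>k * (x v t - \<eta> v t)\<bar> \<le> 0" if t: "t \<in> {0..1}" for t
    by (rule periodic_bound[OF _ diff[OF \<eta>(1)[OF v] res(2)[OF v]] _ _ t])
      (use k(1) fixed \<eta>(4)[OF v] res(4)[OF v] in \<open>auto simp: T_def \<eta>'_def algebra_simps\<close>)
  then have x\<eta>: "x v t = \<eta> v t" if "t \<in> {0..1}" for t using that k(1) by auto
  then have x\<eta>': "x' v t = \<eta>' v t" if "t \<in> {0..1}" for t
    using fixed[OF that] that by (simp add: T_def \<eta>'_def algebra_simps)
  show ?thesis
    using res(2-5)[OF v] \<eta>_between[OF v] x\<eta> x\<eta>'
    by (intro exI[of _ "x v"] exI[of _ "x' v"]) (simp add: s_def)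
qed

section \<open>The periodic boundary value problem\<close>

lemma D01_eq:
  assumes "deriv01 u u'" "t \<in> {0..1}"
  shows "D01 u t = u' t"
  using assms vector_derivative_within_closed_interval[of 0 1 t u "u' t"]
  by (simp add: D01_def has_real_derivative_iff_has_vector_derivative)

lemma C1_01_deriv01:
  assumes "C1_01 u"
  shows "deriv01 u (D01 u)"
proof
  fix t :: real assume "t \<in> {0..1}"
  then have "u differentiable (at t within {0..1})"
    using assms by (simp add: C1_01_def differentiable_on_def)
  then show "(u has_real_derivative D01 u t) (at t within {0..1})"
    by (simp add: D01_def has_real_derivative_iff_has_vector_derivative vector_derivative_works)
qed

lemma deriv01_C1_01:
  assumes "deriv01 u u'" "continuous_on {0..1} u'"
  shows "C1_01 u"
proof -
  have "u differentiable_on {0..1}"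
    using assms(1) by (auto simp: differentiable_on_def real_differentiable_def)
  moreover have "continuous_on {0..1} (D01 u)"
    by (rule iffD2[OF continuous_on_cong[OF refl D01_eq[OF assms(1)]] assms(2)])
  ultimately show ?thesis by (simp add: C1_01_def)
qed

lemma deriv01_transform:
  assumes "deriv01 u u'" "\<And>t. t \<in> {0..1} \<Longrightarrow> u t = v t"
  shows "deriv01 v u'"
proof
  fix t :: real assume t: "t \<in> {0..1}"
  show "(v has_real_derivative u' t) (at t within {0..1})"
    by (rule has_field_derivative_transform_within[OF assms(1)[rule_format, OF t] zero_less_one t])
      (use assms(2) in blast)
qed

section \<open>The characteristic roots, the function \<open>hfun\<close> and the constant
  \<open>k0\<close>\<close>

lemma lam_facts:
  assumes "a > 0"
  shows "0 < lam1 a b" "lam2 a b < 0" "lam1 a b + lam2 a b = - b" "lam1 a b * lam2 a b = - a"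
proof -
  have "\<bar>b\<bar> < sqrt (b\<^sup>2 + 4 * a)"
    using assms by (intro real_less_rsqrt) simp
  then show "0 < lam1 a b" "lam2 a b < 0"
    by (auto simp: lam1_def lam2_def)
  show "lam1 a b + lam2 a b = - b"
    by (simp add: lam1_def lam2_def field_simps)
  have "sqrt (b\<^sup>2 + 4 * a) * sqrt (b\<^sup>2 + 4 * a) = b\<^sup>2 + 4 * a"
    using assms by simp
  then show "lam1 a b * lam2 a b = - a"
    by (simp add: lam1_def lam2_def field_simps power2_eq_square)
qed

lemma hfun_facts:
  fixes a b :: real
  assumes "a > 0"
  defines "p \<equiv> lam1 a b" and "q \<equiv> lam2 a b" and "h \<equiv> hfun a b"
  obtains h1 h2 where "deriv01 h h1" "deriv01 h1 h2" "continuous_on {0..1} h2"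
    and "\<And>t. h2 t = (p + q) * h1 t - p * q * h t"
    and "h 0 = h 1" "h1 1 - h1 0 = 1"
    and "0 < k0 a b" "k0 a b * (exp p - exp q) = - (q * (exp p - 1) + p * (1 - exp q))"
proof -
  have pq: "q < 0" "0 < p" using lam_facts[OF assms(1)] by (auto simp: p_def q_def)
  define D where "D = (p - q) * (exp p - 1) * (1 - exp q)"
  have D: "0 < D" using pq by (simp add: D_def)
  define P where "P = (1 - exp q) / D"
  define Q where "Q = (exp p - 1) / D"
  have h_eq: "h t = P * exp (p * t) + Q * exp (q * t)" for t
    by (simp add: h_def hfun_def D_def p_def q_def P_def Q_def add_divide_distrib)
  define h1 where "h1 t = P * (p * exp (p * t)) + Q * (q * exp (q * t))" for t
  define h2 where "h2 t = P * (p\<^sup>2 * exp (p * t)) + Q * (q\<^sup>2 * exp (q * t))" for t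
  have d1: "deriv01 h h1"
    by (auto intro!: derivative_eq_intros simp: h_eq[abs_def] h1_def)
  have d2: "deriv01 h1 h2"
    by (auto intro!: derivative_eq_intros simp: h1_def[abs_def] h2_def power2_eq_square)
  have c: "continuous_on {0..1} h2"
    unfolding h2_def by (intro continuous_intros)
  have ode: "h2 t = (p + q) * h1 t - p * q * h t" for t
    by (simp add: h1_def h2_def h_eq algebra_simps power2_eq_square)
  \<comment> \<open>This one identity gives both the periodicity of \<open>h\<close> and the unit
    jump of its derivative.\<close>
  have PQ: "P * (exp p - 1) = Q * (1 - exp q)"
    by (simp add: P_def Q_def)
  then have h01: "h 0 = h 1" by (simp add: h_eq algebra_simps)
  have "h1 1 - h1 0 = p * (P * (exp p - 1)) - q * (Q * (1 - exp q))"
    by (simp add: h1_def algebra_simps)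
  also have "\<dots> = (p - q) * (Q * (1 - exp q))"
    unfolding PQ by (simp add: algebra_simps)
  also have "\<dots> = 1" using pq by (simp add: Q_def D_def)
  finally have jump: "h1 1 - h1 0 = 1" .
  have e: "0 < exp p - exp q" using pq by simp
  have "D01 h 0 = h1 0" by (rule D01_eq[OF d1]) simp
  moreover have "h 0 = (exp p - exp q) / D" by (simp add: h_eq P_def Q_def add_divide_distrib[symmetric])
  moreover have "h1 0 = (q * (exp p - 1) + p * (1 - exp q)) / D"
    by (simp add: h1_def P_def Q_def add_divide_distrib[symmetric] mult.commute add.commute)
  ultimately have k: "k0 a b * (exp p - exp q) = - (q * (exp p - 1) + p * (1 - exp q))"
    using D e by (simp add: k0_def h_def[symmetric])
  \<comment> \<open>Positivity of \<open>k0\<close> means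
    \<open>q * (exp p - 1) + p * (1 - exp q) < 0\<close>. The summands are compared with
    \<open>q * p\<close> and \<open>- p * q\<close>; the quadratic Taylor term makes the first
    comparison strict.\<close>
  have "1 + p + p\<^sup>2 / 2 \<le> exp p" by (rule exp_lower_Taylor_quadratic) (use pq in simp)
  then have "p < exp p - 1" using pq by (smt (verit) zero_less_power half_gt_zero)
  then have "q * (exp p - 1) < q * p" using pq by simp
  moreover have "p * (1 - exp q) \<le> p * (- q)"
    using pq exp_ge_add_one_self[of q] by (intro mult_left_mono) linarith+
  ultimately have "0 < k0 a b * (exp p - exp q)" unfolding k by (simp add: algebra_simps)
  then have "0 < k0 a b" using e by (simp add: zero_less_mult_iff)
  then show thesis using that d1 d2 c ode h01 jump k by blast
qed

section \<open>Reduction of problem (P) to the problem between two bounds\<close>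

theorem theorem3p1:
  fixes f :: "real \<Rightarrow> real \<Rightarrow> real \<Rightarrow> real"
    and \<alpha> \<beta> :: "real \<Rightarrow> real"
    and a b \<delta> \<Delta> :: real
  assumes f_cont: "continuous_on ({0..1} \<times> UNIV \<times> UNIV) (\<lambda>(t, x, y). f t x y)"
    and lower: "lower_solution f \<alpha>"
    and upper: "upper_solution f \<beta>"
    and a_pos: "a > 0"
    and f_diff: "\<And>t. t \<in> {0..1} \<Longrightarrow>
      f t (\<beta> t) (D01 \<beta> t) - f t (\<alpha> t) (D01 \<alpha> t)
        \<ge> - a * (\<beta> t - \<alpha> t) + b * (D01 \<beta> t - D01 \<alpha> t) - \<delta>"
    and Delta: "\<Delta> \<ge> \<delta> / 2"
    and f_alpha: "\<And>\<eta> t. \<eta> \<in> A_set a b \<alpha> \<beta> \<Delta> \<Longrightarrow> t \<in> {0..1} \<Longrightarrow>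
      f t (\<eta> t) (D01 \<eta> t) + D01 (D01 \<alpha>) t
        \<ge> - a * (\<eta> t - \<alpha> t) + b * (D01 \<eta> t - D01 \<alpha> t) - \<Delta>"
    and f_beta: "\<And>\<eta> t. \<eta> \<in> A_set a b \<alpha> \<beta> \<Delta> \<Longrightarrow> t \<in> {0..1} \<Longrightarrow>
      f t (\<eta> t) (D01 \<eta> t) + D01 (D01 \<beta>) t
        \<le> a * (\<beta> t - \<eta> t) - b * (D01 \<beta> t - D01 \<eta> t) + \<Delta>"
  shows "\<exists>x. solution_P f x \<and> x \<in> A_set a b \<alpha> \<beta> \<Delta>"
proof -
  define p where "p = lam1 a b"
  define q where "q = lam2 a b"
  define h where "h = hfun a b"
  define k where "k = k0 a b"
  have pq: "q < 0" "0 < p" "p + q = - b" "p * q = - a"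
    using lam_facts[OF a_pos] by (auto simp: p_def q_def)
  obtain h1 h2 where h: "deriv01 h h1" "deriv01 h1 h2" "continuous_on {0..1} h2"
    and h2: "\<And>t. h2 t = - b * h1 t + a * h t"
    and h01: "h 0 = h 1" "h1 1 - h1 0 = 1"
    and k: "0 < k" "k * (exp p - exp q) = - (q * (exp p - 1) + p * (1 - exp q))"
  proof (rule hfun_facts[OF a_pos, of b, folded p_def q_def h_def k_def])
    fix h1 h2 :: "real \<Rightarrow> real"
    assume *: "deriv01 h h1" "deriv01 h1 h2" "continuous_on {0..1} h2" "h 0 = h 1" "h1 1 - h1 0 = 1"
      "0 < k" "k * (exp p - exp q) = - (q * (exp p - 1) + p * (1 - exp q))"
      and "\<And>t. h2 t = (p + q) * h1 t - p * q * h t"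
    then have "h2 t = - b * h1 t + a * h t" for t using pq by simp
    then show thesis using that * by blast
  qed
  have c\<alpha>: "deriv01 \<alpha> (D01 \<alpha>)" "deriv01 (D01 \<alpha>) (D01 (D01 \<alpha>))" "continuous_on {0..1} (D01 (D01 \<alpha>))" "\<alpha> 0 = \<alpha> 1"
    and c\<beta>: "deriv01 \<beta> (D01 \<beta>)" "deriv01 (D01 \<beta>) (D01 (D01 \<beta>))" "continuous_on {0..1} (D01 (D01 \<beta>))" "\<beta> 0 = \<beta> 1"
    using lower upper C1_01_deriv01
    by (auto simp: lower_solution_def upper_solution_def C2_01_def C1_01_def[of "D01 _"])
  \<comment> \<open>As \<open>h\<close> is periodic, \<open>Lh = 0\<close> and \<open>h'\<close> has
    jump 1, adding \<open>r1 \<alpha> * h\<close> removes the derivative mismatch of \<alpha>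
    without changing \<open>L\<alpha>\<close>; the shift by \<open>\<Delta> / a\<close> lowers it by
    \<Delta>. The bound \<open>B\<close> is built likewise from \<beta>.\<close>
  define A where "A = alpha_bar a b \<Delta> \<alpha>"
  define A1 where "A1 t = D01 \<alpha> t + r1 \<alpha> * h1 t" for t
  define A2 where "A2 t = D01 (D01 \<alpha>) t + r1 \<alpha> * h2 t" for t
  define B where "B = beta_bar a b \<Delta> \<beta>"
  define B1 where "B1 t = D01 \<beta> t - r2 \<beta> * h1 t" for t
  define B2 where "B2 t = D01 (D01 \<beta>) t - r2 \<beta> * h2 t" for t
  have A_eq: "A = (\<lambda>t. \<alpha> t + r1 \<alpha> * h t - \<Delta> / a)" and B_eq: "B = (\<lambda>t. \<beta> t - r2 \<beta> * h t + \<Delta> / a)"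
    by (auto simp: A_def B_def alpha_bar_def beta_bar_def h_def)
  have A: "deriv01 A A1" "deriv01 A1 A2" "continuous_on {0..1} A2" "A 0 = A 1" "A1 0 = A1 1"
  proof -
    show "deriv01 A A1" unfolding A_eq A1_def using c\<alpha> h by (auto intro!: derivative_eq_intros)
    show "deriv01 A1 A2" unfolding A1_def[abs_def] A2_def using c\<alpha> h by (auto intro!: derivative_eq_intros)
    show "continuous_on {0..1} A2" unfolding A2_def by (intro continuous_intros c\<alpha> h)
    show "A 0 = A 1" using c\<alpha> h01 by (simp add: A_eq)
    have "A1 0 - A1 1 = r1 \<alpha> - r1 \<alpha> * (h1 1 - h1 0)" by (simp add: A1_def r1_def algebra_simps)
    then show "A1 0 = A1 1" using h01 by simp
  qed
  have B: "deriv01 B B1" "deriv01 B1 B2" "continuous_on {0..1} B2" "B 0 = B 1" "B1 0 = B1 1"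
  proof -
    show "deriv01 B B1" unfolding B_eq B1_def using c\<beta> h by (auto intro!: derivative_eq_intros)
    show "deriv01 B1 B2" unfolding B1_def[abs_def] B2_def using c\<beta> h by (auto intro!: derivative_eq_intros)
    show "continuous_on {0..1} B2" unfolding B2_def by (intro continuous_intros c\<beta> h)
    show "B 0 = B 1" using c\<beta> h01 by (simp add: B_eq)
    have "B1 0 - B1 1 = r2 \<beta> * (h1 1 - h1 0) - r2 \<beta>" by (simp add: B1_def r2_def algebra_simps)
    then show "B1 0 = B1 1" using h01 by simp
  qed
  have LA: "- A2 t + (p + q) * A1 t - p * q * A t = - D01 (D01 \<alpha>) t - b * D01 \<alpha> t + a * \<alpha> t - \<Delta>" for t
    unfolding pq A2_def A1_def A_eq h2 using a_pos by (simp add: algebra_simps)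
  have LB: "- B2 t + (p + q) * B1 t - p * q * B t = - D01 (D01 \<beta>) t - b * D01 \<beta> t + a * \<beta> t + \<Delta>" for t
    unfolding pq B2_def B1_def B_eq h2 using a_pos by (simp add: algebra_simps)
  \<comment> \<open>With the terms in \<open>\<eta>\<close> collected, the conditions with
    \<open>psi1\<close> and \<open>psi2\<close> are bounds on
    \<open>\<eta>' + k * \<eta>\<close>.\<close>
  have A_set_iff: "\<eta> \<in> A_set a b \<alpha> \<beta> \<Delta> \<longleftrightarrow> (\<forall>t\<in>{0..1}. A t \<le> \<eta> t \<and> \<eta> t \<le> B t \<and>
          A1 t + k * A t \<le> \<eta>' t + k * \<eta> t \<and> \<eta>' t + k * \<eta> t \<le> B1 t + k * B t)"
    if "deriv01 \<eta> \<eta>'" "continuous_on {0..1} \<eta>'" for \<eta> \<eta>'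
  proof -
    have "psi1 a b \<Delta> \<alpha> (\<eta> t) t \<le> D01 \<eta> t \<longleftrightarrow> A1 t + k * A t \<le> \<eta>' t + k * \<eta> t"
      "D01 \<eta> t \<le> psi2 a b \<Delta> \<beta> (\<eta> t) t \<longleftrightarrow> \<eta>' t + k * \<eta> t \<le> B1 t + k * B t"
      if "t \<in> {0..1}" for t
      using that D01_eq[OF \<open>deriv01 \<eta> \<eta>'\<close>] D01_eq[OF A(1)] D01_eq[OF B(1)]
      by (auto simp: psi1_def psi2_def A_def[symmetric] B_def[symmetric] k_def[symmetric] algebra_simps)
    then show ?thesis
      using deriv01_C1_01[OF that] by (simp add: A_set_def A_def[symmetric] B_def[symmetric])
  qed
  \<comment> \<open>The right-hand side after \<open>a * x - b * x'\<close> is added to both sides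
    of the equation.\<close>
  define g where "g t x y = f t x y + a * x - b * y" for t x y
  have "\<exists>x x'. deriv01 x x' \<and> deriv01 x' (\<lambda>t. (p + q) * x' t - p * q * x t - g t (x t) (x' t)) \<and>
     x 0 = x 1 \<and> x' 0 = x' 1 \<and>
     (\<forall>t\<in>{0..1}. A t \<le> x t \<and> x t \<le> B t \<and>
          A1 t + k * A t \<le> x' t + k * x t \<and> x' t + k * x t \<le> B1 t + k * B t)"
  proof (rule periodic_problem_between[OF pq(1,2) k _ A B])
    have "continuous_on ({0..1} \<times> UNIV \<times> UNIV)
        (\<lambda>z. (\<lambda>(t, x, y). f t x y) z + a * fst (snd z) - b * snd (snd z))"
      by (intro continuous_intros f_cont)
    then show "continuous_on ({0..1} \<times> UNIV \<times> UNIV) (\<lambda>(t, x, y). g t x y)"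
      by (simp add: g_def case_prod_beta)
  next
    fix t :: real assume t: "t \<in> {0..1}"
    have "- D01 (D01 \<alpha>) t \<le> f t (\<alpha> t) (D01 \<alpha> t)" "f t (\<beta> t) (D01 \<beta> t) \<le> - D01 (D01 \<beta>) t"
      using lower upper t by (auto simp: lower_solution_def upper_solution_def)
    \<comment> \<open>The two shifts open a gap of \<open>2 * \<Delta>\<close>, which absorbs
      \<delta>.\<close>
    then show "- A2 t + (p + q) * A1 t - p * q * A t \<le> - B2 t + (p + q) * B1 t - p * q * B t"
      unfolding LA LB using f_diff[OF t] Delta by (simp add: algebra_simps)
  next
    fix \<eta> \<eta>' :: "real \<Rightarrow> real" and t :: real
    assume \<eta>: "deriv01 \<eta> \<eta>'" "continuous_on {0..1} \<eta>'"
      and between: "\<And>t. t \<in> {0..1} \<Longrightarrow> A t \<le> \<eta> t \<and> \<eta> t \<le> B t \<and>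
          A1 t + k * A t \<le> \<eta>' t + k * \<eta> t \<and> \<eta>' t + k * \<eta> t \<le> B1 t + k * B t"
      and t: "t \<in> {0..1}"
    have "\<eta> \<in> A_set a b \<alpha> \<beta> \<Delta>" using A_set_iff[OF \<eta>] between by blast
    from f_alpha[OF this t] f_beta[OF this t]
    show "- A2 t + (p + q) * A1 t - p * q * A t \<le> g t (\<eta> t) (\<eta>' t) \<and>
        g t (\<eta> t) (\<eta>' t) \<le> - B2 t + (p + q) * B1 t - p * q * B t"
      unfolding LA LB g_def using D01_eq[OF \<eta>(1) t] by (simp add: algebra_simps)
  qed
  then obtain x x' where x: "deriv01 x x'"
    and x': "deriv01 x' (\<lambda>t. (p + q) * x' t - p * q * x t - g t (x t) (x' t))"
    and per: "x 0 = x 1" "x' 0 = x' 1"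
    and between: "\<forall>t\<in>{0..1}. A t \<le> x t \<and> x t \<le> B t \<and>
          A1 t + k * A t \<le> x' t + k * x t \<and> x' t + k * x t \<le> B1 t + k * B t"
    by blast
  have x'f: "deriv01 x' (\<lambda>t. - f t (x t) (x' t))"
    using x' unfolding pq g_def by (simp add: algebra_simps)
  have cx: "continuous_on {0..1} x" and cx': "continuous_on {0..1} x'"
    using deriv01_continuous[OF x] deriv01_continuous[OF x'] .
  have x_mem: "x \<in> A_set a b \<alpha> \<beta> \<Delta>"
    using A_set_iff[OF x cx'] between by blast
  have "continuous_on {0..1} (\<lambda>t. (\<lambda>(t, x, y). f t x y) (t, x t, x' t))"
    by (rule continuous_on_compose2[OF f_cont]) (auto intro!: continuous_intros cx cx')
  then have cf: "continuous_on {0..1} (\<lambda>t. - f t (x t) (x' t))"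
    by (simp add: continuous_on_minus)
  \<comment> \<open>\<open>D01 x\<close> agrees with \<open>x'\<close> only on the interval, so the
    derivative has to be transferred.\<close>
  have D: "deriv01 (D01 x) (\<lambda>t. - f t (x t) (x' t))"
    by (rule deriv01_transform[OF x'f]) (simp add: D01_eq[OF x])
  have "solution_P f x"
    unfolding solution_P_def C2_01_def
    using deriv01_C1_01[OF x cx'] deriv01_C1_01[OF D cf] D01_eq[OF x] D01_eq[OF D] per by simp
  then show ?thesis using x_mem by blast
qed

end
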